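(* Let $\mathcal{A}$ be a semiprime, complex, unital Banach algebra with $\mathrm{soc}(\mathcal{A})\neq\{0\}$, and let $x\in\mathcal{A}$ be B-Fredholm. Then there exists $\varepsilon>0$ such that for all $\lambda\in\mathbb{C}$ with $0<|\lambda|<\varepsilon$ and all sufficiently large $m\in\mathbb{N}$: (1) $x-\lambda$ is Fredholm; (2) $\mathrm{null}(x-\lambda)$ equals the constant $\Theta(R(x)\cap x^{m}\mathcal{A})$, and $\Theta(R(x)\cap x^{m}\mathcal{A})\leq \mathrm{null}(x)$; (3) $\mathrm{def}(x-\lambda)$ equals the constant $\Theta(L(x)\cap \mathcal{A}x^{m})$, and $\Theta(L(x)\cap \mathcal{A}x^{m})\leq \mathrm{def}(x)$.
   Context: An algebra is semiprime if $\{0\}$ is its only two-sided ideal $J$ with $J^2=\{0\}$. The socle $\mathrm{soc}(\mathcal{A})$ is the sum of all minimal right ideals of $\mathcal{A}$ (equal to the sum of all minimal left ideals), or $\{0\}$ if there are none. A right (resp. left) ideal $J$ has finite order if it is a sum of finitely many minimal right (resp. left) ideals; its order $\Theta(J)$ is the smallest number of minimal right (resp. left) ideals with sum $J$; $\Theta(\{0\})=0$, and $\Theta(J)=\infty$ if $J$ does not have finite order. For $x\in\mathcal{A}$: $R(x)=\{a\in\mathcal{A}:xa=0\}$, $L(x)=\{a\in\mathcal{A}:ax=0\}$, $\mathrm{null}(x)=\Theta(R(x))$ (order as a right ideal), $\mathrm{def}(x)=\Theta(L(x))$ (order as a left ideal). An element $a$ of a ring is Drazin invertible if there are $b$ in the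 ring and $k\in\mathbb{N}$ with $bab=b$, $ab=ba$, $a^{k}ba=a^{k}$. An element $a\in\mathcal{A}$ is Fredholm (resp. B-Fredholm) if its image in the quotient algebra $\mathcal{A}/\mathrm{soc}(\mathcal{A})$ is invertible (resp. Drazin invertible). For $\lambda\in\mathbb{C}$, $x-\lambda$ means $x-\lambda 1$. *)

theory Defs
  imports
    "HOL-Analysis.Analysis"
    "HOL-Library.Extended_Nat"
    "HOL-Algebra.QuotRing"
    "HOL-Algebra.Ideal_Product"
    "HOL-Algebra.Algebraic_Closure_Type"
begin

(* Complex unital Banach algebras. The normalisation norm 1 = 1 is not assumed, only
   submultiplicativity of the norm; 1 \<noteq> 0 comes with the class real_algebra_1. *)
class complex_banach_algebra_1 = real_normed_algebra + real_algebra_1 + banach +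
  fixes scaleC :: "complex \<Rightarrow> 'a \<Rightarrow> 'a"  (infixr \<open>*\<^sub>C\<close> 75)
  assumes scaleC_add_right: "c *\<^sub>C (x + y) = c *\<^sub>C x + c *\<^sub>C y"
    and scaleC_add_left: "(c + d) *\<^sub>C x = c *\<^sub>C x + d *\<^sub>C x"
    and scaleC_scaleC: "c *\<^sub>C d *\<^sub>C x = (c * d) *\<^sub>C x"
    and scaleC_of_real: "complex_of_real r *\<^sub>C x = r *\<^sub>R x"
    and mult_scaleC_left: "(c *\<^sub>C x) * y = c *\<^sub>C (x * y)"
    and mult_scaleC_right: "x * (c *\<^sub>C y) = c *\<^sub>C (x * y)"
    and norm_scaleC: "norm (c *\<^sub>C x) = cmod c * norm x"

(* Ideals of a unital algebra are closed under negation and under scalars, since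
   c x = (c 1) x = x (c 1). So ring ideals and algebra ideals coincide, and the notions
   below need only the ring structure. *)

definition right_ideal :: "'a::ring_1 set \<Rightarrow> bool" where
  "right_ideal J \<longleftrightarrow> 0 \<in> J \<and> (\<forall>a\<in>J. \<forall>b\<in>J. a + b \<in> J) \<and> (\<forall>a\<in>J. \<forall>r. a * r \<in> J)"

definition left_ideal :: "'a::ring_1 set \<Rightarrow> bool" where
  "left_ideal J \<longleftrightarrow> 0 \<in> J \<and> (\<forall>a\<in>J. \<forall>b\<in>J. a + b \<in> J) \<and> (\<forall>a\<in>J. \<forall>r. r * a \<in> J)"

definition minimal_right_ideals :: "'a::ring_1 set set" where
  "minimal_right_ideals =
     {J. right_ideal J \<and> J \<noteq> {0} \<and> (\<forall>I. right_ideal I \<and> I \<subseteq> J \<longrightarrow> I = {0} \<or> I = J)}"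

definition minimal_left_ideals :: "'a::ring_1 set set" where
  "minimal_left_ideals =
     {J. left_ideal J \<and> J \<noteq> {0} \<and> (\<forall>I. left_ideal I \<and> I \<subseteq> J \<longrightarrow> I = {0} \<or> I = J)}"

(* The sum of a possibly infinite family of ideals: all finite sums of elements taken from
   members of the family. The empty family has sum {0}. *)
definition ideal_sum :: "'a::ring_1 set set \<Rightarrow> 'a set" where
  "ideal_sum \<F> = {\<Sum>J\<in>\<G>. f J | \<G> f. finite \<G> \<and> \<G> \<subseteq> \<F> \<and> (\<forall>J\<in>\<G>. f J \<in> J)}"

definition socle :: "'a::ring_1 set" where
  "socle = ideal_sum minimal_right_ideals"

(* The infimum of the empty set is \<infinity>, and {0} has order 0 through the empty family. *)
definition right_order :: "'a::ring_1 set \<Rightarrow> enat" where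
  "right_order J =
     Inf {enat (card \<F>) | \<F>. finite \<F> \<and> \<F> \<subseteq> minimal_right_ideals \<and> J = ideal_sum \<F>}"

definition left_order :: "'a::ring_1 set \<Rightarrow> enat" where
  "left_order J =
     Inf {enat (card \<F>) | \<F>. finite \<F> \<and> \<F> \<subseteq> minimal_left_ideals \<and> J = ideal_sum \<F>}"

definition right_annihilator :: "'a::ring_1 \<Rightarrow> 'a set" where
  "right_annihilator x = {a. x * a = 0}"

definition left_annihilator :: "'a::ring_1 \<Rightarrow> 'a set" where
  "left_annihilator x = {a. a * x = 0}"

definition nullity :: "'a::ring_1 \<Rightarrow> enat" where
  "nullity x = right_order (right_annihilator x)"

definition defect :: "'a::ring_1 \<Rightarrow> enat" where
  "defect x = left_order (left_annihilator x)"

definition semiprime_ring :: "('a, 'b) ring_scheme \<Rightarrow> bool" where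
  "semiprime_ring R \<longleftrightarrow>
     (\<forall>J. ideal J R \<and> J \<cdot>\<^bsub>R\<^esub> J = {\<zero>\<^bsub>R\<^esub>} \<longrightarrow> J = {\<zero>\<^bsub>R\<^esub>})"

definition drazin_invertible :: "('a, 'b) ring_scheme \<Rightarrow> 'a \<Rightarrow> bool" where
  "drazin_invertible R a \<longleftrightarrow> a \<in> carrier R \<and>
     (\<exists>b\<in>carrier R. \<exists>k::nat.
        b \<otimes>\<^bsub>R\<^esub> a \<otimes>\<^bsub>R\<^esub> b = b \<and>
        a \<otimes>\<^bsub>R\<^esub> b = b \<otimes>\<^bsub>R\<^esub> a \<and>
        (a [^]\<^bsub>R\<^esub> k) \<otimes>\<^bsub>R\<^esub> b \<otimes>\<^bsub>R\<^esub> a = a [^]\<^bsub>R\<^esub> k)"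

(* Quot and +> give the expected quotient ring only for a two-sided ideal;
   the socle is one when the algebra is semiprime. *)
definition fredholm :: "'a::ring_1 \<Rightarrow> bool" where
  "fredholm x \<longleftrightarrow>
     socle +>\<^bsub>ring_of_type_algebra\<^esub> x \<in> Units (ring_of_type_algebra Quot socle)"

definition b_fredholm :: "'a::ring_1 \<Rightarrow> bool" where
  "b_fredholm x \<longleftrightarrow>
     drazin_invertible (ring_of_type_algebra Quot socle) (socle +>\<^bsub>ring_of_type_algebra\<^esub> x)"

end

theory Submission
  imports Defs
begin

text \<open>
  Let \<open>K\<^sub>m = R(x) \<inter> x\<^sup>m A\<close>. Elements of the socle generate right ideals of finite order, which satisfy the
  descending chain condition, so \<open>K\<^sub>m\<close> is constant for \<open>m \<ge> M\<close>. Elements of the socle are von Neumann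
  regular, and \<open>x\<^sup>n\<close> is regular modulo the socle for large \<open>n\<close>; hence \<open>x\<^sup>M\<^sup>+\<^sup>1 w x\<^sup>M\<^sup>+\<^sup>1 = x\<^sup>M\<^sup>+\<^sup>1\<close> for
  some \<open>w\<close>. With \<open>s = x\<^sup>M w\<close>, left multiplication by the unit \<open>1 - \<lambda> s\<close> maps \<open>R(x - \<lambda>)\<close> onto \<open>K\<^sub>M\<close> for
  small \<open>\<lambda> \<noteq> 0\<close>, so both have the same order. The defect is treated in the opposite ring, with
  \<open>w x\<^sup>M\<close> in place of \<open>s\<close>.
\<close>

section \<open>Sums of one-sided ideals\<close>

text \<open>The nullity of \<open>x\<close> may be infinite, so everything is measured inside
  \<open>x ^ m A\<close>: for large \<open>m\<close>, an element there that \<open>x\<close>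
  annihilates is a multiple of one fixed socle element. The order then has to behave like the length
  of a semisimple module and drop strictly on proper subideals. Semiprimeness provides this, because
  right ideals of finite order are generated by idempotents and therefore have complements. The
  exponent \<open>Suc M\<close> in the regularity relation, one above the stable exponent, is what
  makes \<open>x * s\<close> act as the identity on \<open>x ^ Suc M A\<close>. The socle is defined
  through right ideals, whereas the defect concerns left ideals. Passing to the opposite ring avoids
  a second copy of the theory, at a price: that ring carries no norm, so the kernel argument must be
  purely algebraic, and socle elements must be shown to stay in the socle there.\<close>

definition add_closed :: "'a::ring_1 set \<Rightarrow> bool" where
  "add_closed J \<longleftrightarrow> 0 \<in> J \<and> (\<forall>a\<in>J. \<forall>b\<in>J. a + b \<in> J)"

lemma right_ideal_add_closed: "right_ideal J \<Longrightarrow> add_closed J"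
  by (simp add: right_ideal_def add_closed_def)

lemma left_ideal_add_closed: "left_ideal J \<Longrightarrow> add_closed J"
  by (simp add: left_ideal_def add_closed_def)

lemma ideal_sum_zero: "0 \<in> ideal_sum \<F>"
  unfolding ideal_sum_def by (intro CollectI exI[of _ "{}"]) auto

lemma ideal_sum_member:
  assumes "J \<in> \<F>" "a \<in> J"
  shows "a \<in> ideal_sum \<F>"
  unfolding ideal_sum_def using assms
  by (intro CollectI exI[of _ "{J}"] exI[of _ "\<lambda>_. a"]) auto

lemma ideal_sum_add:
  assumes closed: "\<And>J. J \<in> \<F> \<Longrightarrow> add_closed J"
    and "a \<in> ideal_sum \<F>" "b \<in> ideal_sum \<F>"
  shows "a + b \<in> ideal_sum \<F>"
proof -
  obtain \<G> f where G: "finite \<G>" "\<G> \<subseteq> \<F>" "\<forall>J\<in>\<G>. f J \<in> J" "a = (\<Sum>J\<in>\<G>. f J)"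
    using assms(2) by (auto simp: ideal_sum_def)
  obtain \<H> g where H: "finite \<H>" "\<H> \<subseteq> \<F>" "\<forall>J\<in>\<H>. g J \<in> J" "b = (\<Sum>J\<in>\<H>. g J)"
    using assms(3) by (auto simp: ideal_sum_def)
  define h where "h = (\<lambda>J. (if J \<in> \<G> then f J else 0) + (if J \<in> \<H> then g J else 0))"
  have "(\<Sum>J\<in>\<G>. f J) = (\<Sum>J\<in>\<G>\<union>\<H>. if J \<in> \<G> then f J else 0)"
    using G(1) H(1) by (intro sum.mono_neutral_cong_left) auto
  moreover have "(\<Sum>J\<in>\<H>. g J) = (\<Sum>J\<in>\<G>\<union>\<H>. if J \<in> \<H> then g J else 0)"
    using G(1) H(1) by (intro sum.mono_neutral_cong_left) auto
  ultimately have "a + b = (\<Sum>J\<in>\<G>\<union>\<H>. h J)"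
    using G H by (simp add: h_def sum.distrib)
  moreover have "h J \<in> J" if "J \<in> \<G> \<union> \<H>" for J
    using that G H closed[of J] by (auto simp: h_def add_closed_def)
  ultimately show ?thesis
    unfolding ideal_sum_def using G(1,2) H(1,2)
    by (intro CollectI exI[of _ "\<G> \<union> \<H>"] exI[of _ h]) auto
qed

lemma ideal_sum_induct [consumes 1, case_names zero member add]:
  assumes "x \<in> ideal_sum \<F>" "P 0" "\<And>J a. J \<in> \<F> \<Longrightarrow> a \<in> J \<Longrightarrow> P a"
    "\<And>a b. P a \<Longrightarrow> P b \<Longrightarrow> P (a + b)"
  shows "P x"
proof -
  obtain \<G> f where G: "finite \<G>" "\<G> \<subseteq> \<F>" "\<forall>J\<in>\<G>. f J \<in> J" and x: "x = (\<Sum>J\<in>\<G>. f J)"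
    using assms(1) by (auto simp: ideal_sum_def)
  from G have "P (\<Sum>J\<in>\<G>. f J)"
    by (induction rule: finite_induct) (auto intro: assms)
  then show ?thesis by (simp add: x)
qed

lemma ideal_sum_empty: "ideal_sum {} = {0}"
  by (auto simp: ideal_sum_def)

lemma ideal_sum_mono: "\<F> \<subseteq> \<G> \<Longrightarrow> ideal_sum \<F> \<subseteq> ideal_sum \<G>"
  unfolding ideal_sum_def by blast

lemma ideal_sum_least:
  assumes "add_closed I" "\<And>J. J \<in> \<F> \<Longrightarrow> J \<subseteq> I"
  shows "ideal_sum \<F> \<subseteq> I"
proof
  fix x assume "x \<in> ideal_sum \<F>"
  then show "x \<in> I"
    by (induction rule: ideal_sum_induct) (use assms in \<open>auto simp: add_closed_def\<close>)
qed

lemma add_closed_plus: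
  assumes "add_closed I" "add_closed J"
  shows "add_closed (I + J)"
  unfolding add_closed_def
proof (intro conjI ballI)
  show "0 \<in> I + J"
    using assms set_plus_intro[of 0 I 0 J] by (simp add: add_closed_def)
next
  fix a b assume "a \<in> I + J" "b \<in> I + J"
  then obtain i j i' j' where "i \<in> I" "j \<in> J" "i' \<in> I" "j' \<in> J" "a = i + j" "b = i' + j'"
    by (auto elim!: set_plus_elim)
  then show "a + b \<in> I + J"
    using assms set_plus_intro[of "i + i'" I "j + j'" J]
    by (simp add: add_closed_def algebra_simps)
qed

lemma add_closed_ideal_sum:
  assumes "\<And>J. J \<in> \<F> \<Longrightarrow> add_closed J"
  shows "add_closed (ideal_sum \<F>)"
  unfolding add_closed_def using ideal_sum_zero ideal_sum_add[OF assms] by blast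

lemma ideal_sum_insert:
  assumes "\<And>J. J \<in> insert S \<F> \<Longrightarrow> add_closed J"
  shows "ideal_sum (insert S \<F>) = ideal_sum \<F> + S"
proof
  have F: "add_closed (ideal_sum \<F>)"
    using assms by (intro add_closed_ideal_sum) simp
  show "ideal_sum (insert S \<F>) \<subseteq> ideal_sum \<F> + S"
  proof (rule ideal_sum_least)
    show "add_closed (ideal_sum \<F> + S)"
      using F assms by (simp add: add_closed_plus)
  next
    fix J assume "J \<in> insert S \<F>"
    then consider "J = S" | "J \<in> \<F>" by blast
    then show "J \<subseteq> ideal_sum \<F> + S"
    proof cases
      case 1
      then show ?thesis
        using set_zero_plus2[OF ideal_sum_zero] by blast
    next
      case 2
      have "0 \<in> S" using assms by (simp add: add_closed_def)
      then have "ideal_sum \<F> \<subseteq> S + ideal_sum \<F>" by (rule set_zero_plus2)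
      with 2 show ?thesis
        using ideal_sum_member by (metis add.commute subset_iff)
    qed
  qed
  show "ideal_sum \<F> + S \<subseteq> ideal_sum (insert S \<F>)"
    using assms ideal_sum_add[of "insert S \<F>"] ideal_sum_member[of S "insert S \<F>"]
      ideal_sum_mono[OF subset_insertI]
    by (fastforce elim!: set_plus_elim)
qed

text \<open>Only additivity of \<open>h\<close> is demanded, since the map to the opposite ring, to
  which this is applied, reverses products.\<close>

lemma ideal_sum_image:
  assumes add: "\<And>a b. h (a + b) = h a + h b" and zero: "h 0 = 0"
    and closed: "\<And>J. J \<in> \<F> \<Longrightarrow> add_closed J"
  shows "ideal_sum ((`) h ` \<F>) = h ` ideal_sum \<F>"
proof
  have img: "add_closed (h ` J)" if "add_closed J" for J
    unfolding add_closed_def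
  proof (intro conjI ballI)
    show "0 \<in> h ` J"
      using that zero[symmetric] by (auto simp: add_closed_def)
  next
    fix a b assume "a \<in> h ` J" "b \<in> h ` J"
    then obtain a' b' where "a' \<in> J" "b' \<in> J" "a = h a'" "b = h b'" by blast
    then show "a + b \<in> h ` J"
      using that add[of a' b', symmetric] by (auto simp: add_closed_def)
  qed
  show "ideal_sum ((`) h ` \<F>) \<subseteq> h ` ideal_sum \<F>"
  proof (rule ideal_sum_least)
    show "add_closed (h ` ideal_sum \<F>)"
      using closed by (intro img add_closed_ideal_sum)
  qed (auto intro: ideal_sum_member)
  show "h ` ideal_sum \<F> \<subseteq> ideal_sum ((`) h ` \<F>)"
  proof clarify
    fix x assume "x \<in> ideal_sum \<F>"
    then show "h x \<in> ideal_sum ((`) h ` \<F>)"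
    proof (induction rule: ideal_sum_induct)
      case zero
      show ?case by (simp add: assms(2) ideal_sum_zero)
    next
      case (member J a)
      then show ?case by (intro ideal_sum_member[of "h ` J"]) auto
    next
      case (add a b)
      then show ?case using closed img by (auto simp: assms(1) intro!: ideal_sum_add)
    qed
  qed
qed

section \<open>Right ideals\<close>

lemma right_ideal_minus:
  assumes "right_ideal J" "a \<in> J" "b \<in> J"
  shows "a - b \<in> J"
proof -
  have "b * (- 1) \<in> J" using assms unfolding right_ideal_def by blast
  then have "a + b * (- 1) \<in> J" using assms unfolding right_ideal_def by blast
  then show ?thesis by simp
qed

lemma right_ideal_range: "right_ideal (range ((*) a))"
  unfolding right_ideal_def
proof (intro conjI ballI allI)
  show "0 \<in> range ((*) a)" by (rule range_eqI[of _ _ 0]) simp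
  show "x + y \<in> range ((*) a)" if xy: "x \<in> range ((*) a)" "y \<in> range ((*) a)" for x y
  proof -
    obtain x' y' where "x = a * x'" "y = a * y'" using xy by blast
    then show ?thesis by (intro range_eqI[of _ _ "x' + y'"]) (simp add: distrib_left)
  qed
  show "x * r \<in> range ((*) a)" if x: "x \<in> range ((*) a)" for x r
  proof -
    obtain x' where "x = a * x'" using x by blast
    then show ?thesis by (intro range_eqI[of _ _ "x' * r"]) (simp add: mult.assoc)
  qed
qed

lemma right_ideal_image:
  assumes "right_ideal J"
  shows "right_ideal ((*) r ` J)"
  unfolding right_ideal_def
proof (intro conjI ballI allI)
  show "0 \<in> (*) r ` J"
    using assms by (intro image_eqI[of _ _ 0]) (auto simp: right_ideal_def)
  show "x + y \<in> (*) r ` J" if xy: "x \<in> (*) r ` J" "y \<in> (*) r ` J" for x y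
  proof -
    obtain x' y' where "x' \<in> J" "y' \<in> J" "x = r * x'" "y = r * y'" using xy by blast
    then show ?thesis
      using assms by (intro image_eqI[of _ _ "x' + y'"]) (auto simp: right_ideal_def distrib_left)
  qed
  show "x * s \<in> (*) r ` J" if x: "x \<in> (*) r ` J" for x s
  proof -
    obtain x' where "x' \<in> J" "x = r * x'" using x by blast
    then show ?thesis
      using assms by (intro image_eqI[of _ _ "x' * s"]) (auto simp: right_ideal_def mult.assoc)
  qed
qed

lemma right_ideal_vimage:
  assumes "right_ideal I"
  shows "right_ideal {a. r * a \<in> I}"
  using assms unfolding right_ideal_def
  by (auto simp: distrib_left mult.assoc[symmetric])

lemma right_ideal_Int: "right_ideal I \<Longrightarrow> right_ideal J \<Longrightarrow> right_ideal (I \<inter> J)"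
  by (auto simp: right_ideal_def)

lemma right_ideal_annihilator: "right_ideal (right_annihilator x)"
  by (auto simp: right_ideal_def right_annihilator_def distrib_left mult.assoc[symmetric])

lemma right_ideal_plus:
  assumes "right_ideal I" "right_ideal J"
  shows "right_ideal (I + J)"
  using add_closed_plus[OF assms[THEN right_ideal_add_closed]] assms
  by (auto simp: right_ideal_def add_closed_def elim!: set_plus_elim) (metis distrib_right set_plus_intro)

lemma right_ideal_ideal_sum:
  assumes "\<And>J. J \<in> \<F> \<Longrightarrow> right_ideal J"
  shows "right_ideal (ideal_sum \<F>)"
  unfolding right_ideal_def
proof (intro conjI ballI allI)
  show "a * r \<in> ideal_sum \<F>" if "a \<in> ideal_sum \<F>" for a r
    using that
  proof (induction rule: ideal_sum_induct)
    case zero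
    show ?case by (simp add: ideal_sum_zero)
  next
    case (member J a)
    then show ?case using assms by (intro ideal_sum_member[of J]) (auto simp: right_ideal_def)
  next
    case (add a b)
    then show ?case
      unfolding distrib_right by (intro ideal_sum_add) (use assms right_ideal_add_closed in blast)+
  qed
qed (use assms right_ideal_add_closed ideal_sum_zero ideal_sum_add in blast)+

lemma minimal_right_idealD:
  assumes "S \<in> minimal_right_ideals"
  shows "right_ideal S" "S \<noteq> {0}" "\<And>I. right_ideal I \<Longrightarrow> I \<subseteq> S \<Longrightarrow> I \<noteq> {0} \<Longrightarrow> I = S"
  using assms by (auto simp: minimal_right_ideals_def)

lemma minimal_right_ideal_nonzero:
  assumes "S \<in> minimal_right_ideals"
  obtains a where "a \<in> S" "a \<noteq> 0"
  using minimal_right_idealD(1,2)[OF assms] by (auto simp: right_ideal_def)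

text \<open>Left multiplication by \<open>r\<close> is a homomorphism of right modules, so a
  subideal of the image pulls back to a subideal of \<open>S\<close>, which is \<open>{0}\<close> or
  \<open>S\<close>.\<close>

lemma minimal_right_ideal_image:
  assumes S: "S \<in> minimal_right_ideals" and nz: "(*) r ` S \<noteq> {0}"
  shows "(*) r ` S \<in> minimal_right_ideals"
  unfolding minimal_right_ideals_def
proof (intro CollectI conjI allI impI nz)
  note S' = minimal_right_idealD[OF S]
  show "right_ideal ((*) r ` S)" using S'(1) by (rule right_ideal_image)
  fix I assume I: "right_ideal I \<and> I \<subseteq> (*) r ` S"
  define K where "K = S \<inter> {a. r * a \<in> I}"
  have K: "right_ideal K" "K \<subseteq> S" "(*) r ` K = I"
    using I S'(1) by (auto simp: K_def intro!: right_ideal_Int right_ideal_vimage)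
  show "I = {0} \<or> I = (*) r ` S"
  proof (cases "K = {0}")
    case True
    then show ?thesis using K(3) by auto
  next
    case False
    then show ?thesis using S'(3)[OF K(1,2)] K(3) by auto
  qed
qed

section \<open>The order of a right ideal\<close>

text \<open>The infimum of a nonempty set in \<open>enat\<close> is attained. The bound "at most
  \<open>n\<close>" instead of "exactly \<open>n\<close>" is the form suited to induction: summands
  may vanish or coincide without spoiling it.\<close>

lemma right_order_le_iff:
  "right_order J \<le> enat n \<longleftrightarrow>
     (\<exists>\<F>. finite \<F> \<and> \<F> \<subseteq> minimal_right_ideals \<and> card \<F> \<le> n \<and> J = ideal_sum \<F>)"
    (is "_ \<longleftrightarrow> ?R")
proof
  let ?X = "{enat (card \<F>) | \<F>. finite \<F> \<and> \<F> \<subseteq> minimal_right_ideals \<and> J = ideal_sum \<F>}"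
  assume L: "right_order J \<le> enat n"
  then have "?X \<noteq> {}"
    unfolding right_order_def by (metis (no_types, lifting) Inf_enat_def infinity_ileE)
  then have "Inf ?X \<in> ?X" by (meson ex_in_conv wellorder_InfI)
  then show ?R using L unfolding right_order_def by auto
next
  assume ?R
  then obtain \<F> where F: "finite \<F>" "\<F> \<subseteq> minimal_right_ideals" "card \<F> \<le> n" "J = ideal_sum \<F>"
    by blast
  then have "right_order J \<le> enat (card \<F>)"
    unfolding right_order_def by (intro Inf_lower) auto
  with F(3) show "right_order J \<le> enat n" by (meson enat_ord_simps(1) order_trans)
qed

lemma right_order_zero_iff: "right_order J \<le> enat 0 \<longleftrightarrow> J = {0}"
  unfolding right_order_le_iff by (auto simp: ideal_sum_empty)

lemma right_order_finite_right_ideal: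
  assumes "right_order J \<le> enat n"
  shows "right_ideal J"
  using assms minimal_right_idealD(1) unfolding right_order_le_iff
  by (blast intro: right_ideal_ideal_sum)

lemma right_order_Suc_cases:
  assumes "right_order J \<le> enat (Suc n)"
  obtains "right_order J \<le> enat n"
  | J' S where "right_order J' \<le> enat n" "S \<in> minimal_right_ideals" "J = J' + S"
proof -
  obtain \<F> where F: "finite \<F>" "\<F> \<subseteq> minimal_right_ideals" "card \<F> \<le> Suc n" "J = ideal_sum \<F>"
    using right_order_le_iff[THEN iffD1, OF assms] by blast
  show thesis
  proof (cases "card \<F> \<le> n")
    case True
    then have "right_order J \<le> enat n"
      unfolding right_order_le_iff using F by blast
    then show thesis by (rule that(1))
  next
    case False
    then have "card \<F> = Suc n" using F(3) by simp
    then obtain S \<G> where G: "\<F> = insert S \<G>" "S \<notin> \<G>" "card \<G> = n"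
      by (metis card_Suc_eq)
    have "J = ideal_sum \<G> + S"
      using F(2,4) minimal_right_idealD(1) right_ideal_add_closed
      unfolding G(1) by (subst ideal_sum_insert[symmetric]) blast+
    moreover have "right_order (ideal_sum \<G>) \<le> enat n"
      using F(1,2) G right_order_le_iff by auto
    ultimately show thesis using that(2) F(2) G(1) by blast
  qed
qed

lemma right_order_add_minimal:
  assumes "right_order J \<le> enat n" "S \<in> minimal_right_ideals"
  shows "right_order (J + S) \<le> enat (Suc n)"
proof -
  obtain \<F> where F: "finite \<F>" "\<F> \<subseteq> minimal_right_ideals" "card \<F> \<le> n" "J = ideal_sum \<F>"
    using right_order_le_iff[THEN iffD1, OF assms(1)] by blast
  have "J + S = ideal_sum (insert S \<F>)"
    using F(2,4) assms(2) minimal_right_idealD(1) right_ideal_add_closed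
    by (subst ideal_sum_insert) blast+
  moreover have "card (insert S \<F>) \<le> Suc n"
    using F(3) card_insert_le_m1[of "Suc n" \<F> S] by simp
  ultimately show ?thesis
    unfolding right_order_le_iff using F(1,2) assms(2) by (intro exI[of _ "insert S \<F>"]) auto
qed

text \<open>Each minimal summand is sent to \<open>{0}\<close> or to a minimal right ideal, so the
  number of summands cannot grow.\<close>

lemma right_order_image_le: "right_order ((*) r ` J) \<le> right_order J"
proof (cases "right_order J")
  case (enat n)
  have "right_order ((*) r ` J) \<le> enat n" if "right_order J \<le> enat n" for n
    using that
  proof (induction n arbitrary: J)
    case 0
    then show ?case by (simp add: right_order_zero_iff)
  next
    case (Suc n)
    from Suc.prems show ?case
    proof (cases rule: right_order_Suc_cases)
      case 1
      then show ?thesis using Suc.IH[of J] by (meson enat_ord_simps(1) le_SucI order_refl order_trans)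
    next
      case (2 J' S)
      have eq: "(*) r ` J = (*) r ` J' + (*) r ` S"
        unfolding 2(3) set_plus_def by (auto simp: image_iff distrib_left; metis distrib_left)
      show ?thesis
      proof (cases "(*) r ` S = {0}")
        case True
        then have "(*) r ` J = (*) r ` J'" unfolding eq by (simp add: set_plus_def)
        then show ?thesis
          using Suc.IH[OF 2(1)] by (metis enat_ord_simps(1) le_SucI order_refl order_trans)
      next
        case False
        then show ?thesis
          unfolding eq using Suc.IH[OF 2(1)] minimal_right_ideal_image[OF 2(2)]
          by (intro right_order_add_minimal)
      qed
    qed
  qed
  then show ?thesis using enat by simp
qed simp

section \<open>Finite order in semiprime rings\<close>

text \<open>The elementwise form of semiprimeness. It is symmetric in left and right, and the type
  argument lets the whole theory be interpreted a second time at the opposite ring.\<close>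

locale semiprime_type =
  fixes ring_type :: "'a::ring_1 itself"
  assumes semiprime: "(\<And>r. x * r * x = 0) \<Longrightarrow> x = (0::'a)"
begin

text \<open>Brauer's lemma. Semiprimeness yields \<open>s\<close> in \<open>S\<close> with
  \<open>s S\<close> nonzero, hence \<open>s S = S\<close> and \<open>s = s * f\<close> for some
  \<open>f\<close> in \<open>S\<close>. By minimality nothing but 0 in \<open>S\<close> is
  annihilated by \<open>s\<close>, and \<open>f * f - f\<close> is annihilated.\<close>

lemma minimal_right_ideal_idempotent:
  fixes S :: "'a set"
  assumes S: "S \<in> minimal_right_ideals"
  obtains f where "f * f = f" "f \<noteq> 0" "S = range ((*) f)"
proof -
  note S' = minimal_right_idealD[OF S]
  obtain a where a: "a \<in> S" "a \<noteq> 0" using minimal_right_ideal_nonzero[OF S] .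
  obtain r where r: "a * r * a \<noteq> 0" using semiprime[of a] a(2) by blast
  define s where "s = a * r"
  have s: "s \<in> S" using a(1) S'(1) by (simp add: s_def right_ideal_def)
  have sub: "(*) s ` S \<subseteq> S" using s S'(1) by (auto simp: right_ideal_def)
  have "(*) s ` S \<noteq> {0}" using a(1) r by (force simp: s_def)
  then have "(*) s ` S = S" using S'(3)[OF right_ideal_image[OF S'(1)] sub] by blast
  then obtain f where f: "f \<in> S" "s = s * f" using s by blast
  define Z where "Z = S \<inter> right_annihilator s"
  have Z: "right_ideal Z" "Z \<subseteq> S"
    using S'(1) right_ideal_annihilator by (auto simp: Z_def intro: right_ideal_Int)
  have "a \<notin> Z" using r by (simp add: Z_def right_annihilator_def s_def)
  then have "Z = {0}" using S'(3)[OF Z] a(1) by blast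
  moreover have "f * f - f \<in> Z"
  proof -
    have "f * f - f \<in> S" using f(1) S'(1) by (intro right_ideal_minus) (auto simp: right_ideal_def)
    moreover have "s * (f * f - f) = 0" using f(2) by (simp add: right_diff_distrib mult.assoc[symmetric])
    ultimately show ?thesis by (simp add: Z_def right_annihilator_def)
  qed
  ultimately have idem: "f * f = f" by simp
  have "s \<noteq> 0" using r by (auto simp: s_def)
  then have f0: "f \<noteq> 0" using f(2) by auto
  have "range ((*) f) \<subseteq> S" using f(1) S'(1) by (auto simp: right_ideal_def)
  moreover have "range ((*) f) \<noteq> {0}" using f0 idem by (metis rangeI singletonD)
  ultimately have "S = range ((*) f)" using S'(3)[OF right_ideal_range] by blast
  with idem f0 show thesis by (rule that)
qed

text \<open>Gram-Schmidt for idempotents: replacing the new summand \<open>S\<close> by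
  \<open>(1 - e) S\<close> keeps the sum with \<open>e A\<close> and makes the new generator
  \<open>f\<close> satisfy \<open>e * f = 0\<close>.\<close>

lemma finite_order_idempotent:
  fixes J :: "'a set"
  assumes "right_order J \<le> enat n"
  shows "\<exists>e. e * e = e \<and> J = range ((*) e)"
  using assms
proof (induction n arbitrary: J)
  case 0
  then have "J = range ((*) 0)" by (auto simp: right_order_zero_iff)
  then show ?case by (metis mult_zero_left)
next
  case (Suc n)
  from Suc.prems show ?case
  proof (cases rule: right_order_Suc_cases)
    case 1
    then show ?thesis by (rule Suc.IH)
  next
    case (2 J' S)
    obtain e where e: "e * e = e" "J' = range ((*) e)" using Suc.IH[OF 2(1)] by blast
    have S: "right_ideal S" using minimal_right_idealD(1)[OF 2(2)] .
    define T where "T = (*) (1 - e) ` S"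
    have J: "J = J' + T"
    proof
      show "J \<subseteq> J' + T"
      proof
        fix x assume "x \<in> J"
        then obtain a s where s: "s \<in> S" "x = e * a + s" using 2(3) e(2) by (auto elim!: set_plus_elim)
        then have "x = e * (a + s) + (1 - e) * s" by (simp add: algebra_simps)
        then show "x \<in> J' + T" using s(1) e(2) unfolding T_def by (metis image_eqI rangeI set_plus_intro)
      qed
      show "J' + T \<subseteq> J"
      proof
        fix x assume "x \<in> J' + T"
        then obtain a s where s: "s \<in> S" "x = e * a + (1 - e) * s" 
          using e(2) by (auto simp: T_def elim!: set_plus_elim)
        then have "x = e * (a - s) + s" by (simp add: algebra_simps)
        then show "x \<in> J" using s(1) e(2) unfolding 2(3) by (metis rangeI set_plus_intro)
      qed
    qed
    show ?thesis
    proof (cases "T = {0}")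
      case True
      then show ?thesis using J e by (intro exI[of _ e]) (simp add: set_plus_def)
    next
      case False
      then have "T \<in> minimal_right_ideals"
        unfolding T_def by (rule minimal_right_ideal_image[OF 2(2)])
      then obtain f where f: "f * f = f" "T = range ((*) f)"
        using minimal_right_ideal_idempotent by metis
      have "f \<in> T" unfolding f(2) by (rule range_eqI[of _ _ 1]) simp
      then obtain s where "f = (1 - e) * s" by (auto simp: T_def)
      then have "e * f = (e * (1 - e)) * s" by (simp add: mult.assoc)
      then have ef: "e * f = 0" using e(1) by (simp add: right_diff_distrib)
      \<comment> \<open>\<open>f * e\<close> may be nonzero, so \<open>e + f\<close> need not be
        idempotent. The correction gives \<open>e * g = g * e = 0\<close> and keeps
        \<open>g * f = f\<close>, so \<open>e + g\<close> is an idempotent fixing both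
        summands.\<close>
      define g where "g = f - f * e"
      have fe: "f * (e * z) = f * e * z" "e * (f * z) = 0" "f * (f * z) = f * z" "e * (e * z) = e * z" for z
        using ef f(1) e(1) by (metis mult.assoc mult_zero_left)+
      have "(e + g) * (e + g) = e + g"
        using e(1) f(1) ef fe by (simp add: g_def algebra_simps)
      moreover have "J = range ((*) (e + g))"
      proof
        show "J \<subseteq> range ((*) (e + g))"
        proof
          fix x assume "x \<in> J"
          then obtain a c where x: "x = e * a + f * c" using J e(2) f(2) by (auto elim!: set_plus_elim)
          have "(e + g) * x = x" unfolding x using fe by (simp add: g_def algebra_simps)
          then show "x \<in> range ((*) (e + g))" by (metis rangeI)
        qed
        show "range ((*) (e + g)) \<subseteq> J"
        proof
          fix x assume "x \<in> range ((*) (e + g))"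
          then obtain a where "x = e * a + f * (a - e * a)" by (auto simp: g_def algebra_simps)
          then show "x \<in> J" unfolding J e(2) f(2) by (metis rangeI set_plus_intro)
        qed
      qed
      ultimately show ?thesis by blast
    qed
  qed
qed

text \<open>The order acts as a length. For \<open>J = J' + S\<close> and \<open>I\<close> not
  inside \<open>J'\<close>, the part \<open>I \<inter> J'\<close> is proper in \<open>J'\<close> and
  has order below \<open>n\<close> by induction; what \<open>I\<close> has beyond it is a single
  minimal right ideal.\<close>

lemma right_order_psubset:
  fixes J :: "'a set"
  assumes "right_order J \<le> enat n" "right_ideal I" "I \<subset> J"
  shows "right_order I < enat n"
  using assms
proof (induction n arbitrary: I J)
  case 0
  then show ?case by (auto simp: right_order_zero_iff right_ideal_def)
next
  case (Suc n)
  have le: "right_order K < enat n \<Longrightarrow> right_order K < enat (Suc n)" for K :: "'a set"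
    by (metis enat_ord_simps(2) less_SucI less_trans lessI)
  have le': "right_order K \<le> enat n \<Longrightarrow> right_order K < enat (Suc n)" for K :: "'a set"
    by (metis enat_ord_simps(2) le_less_trans lessI)
  from Suc.prems(1) show ?case
  proof (cases rule: right_order_Suc_cases)
    case 1
    then show ?thesis using Suc.IH Suc.prems le by blast
  next
    case (2 J' S)
    note S = minimal_right_idealD[OF 2(2)]
    have J': "right_ideal J'" using right_order_finite_right_ideal[OF 2(1)] .
    have J'J: "J' \<subseteq> J" using S(1) unfolding 2(3)
      by (metis add.commute right_ideal_def set_zero_plus2)
    show ?thesis
    proof (cases "S \<subseteq> J'")
      case True
      then have "J = J'" using J' J'J unfolding 2(3)
        by (auto simp: right_ideal_def elim!: set_plus_elim)
      then show ?thesis using Suc.IH[OF 2(1)] Suc.prems le by blast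
    next
      case notsub: False
      have J'S: "J' \<inter> S = {0}" using S(3)[OF right_ideal_Int[OF J' S(1)]] notsub by blast
      show ?thesis
      proof (cases "I \<subseteq> J'")
        case True
        then show ?thesis using Suc.IH[OF 2(1) Suc.prems(2)] 2(1) le le' by blast
      next
        case notI: False
        \<comment> \<open>If \<open>I\<close> contained \<open>J'\<close>, an element of
          \<open>I\<close> outside \<open>J'\<close> would have a nonzero \<open>S\<close>-component
          lying in \<open>I\<close>, and minimality of \<open>S\<close> would force
          \<open>I = J\<close>.\<close>
        have ne: "I \<inter> J' \<noteq> J'"
        proof
          assume "I \<inter> J' = J'"
          then have sub: "J' \<subseteq> I" by blast
          obtain a where a: "a \<in> I" "a \<notin> J'" using notI by blast
          obtain j s where js: "j \<in> J'" "s \<in> S" "a = j + s"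
            using a(1) Suc.prems(3) 2(3) by (blast elim: set_plus_elim)
          have "s \<in> I" using right_ideal_minus[OF Suc.prems(2) a(1), of j] js sub by auto
          moreover have "s \<noteq> 0" using a(2) js by auto
          ultimately have "I \<inter> S = S"
            using S(3)[OF right_ideal_Int[OF Suc.prems(2) S(1)]] js(2) by blast
          then have "J \<subseteq> I" using sub Suc.prems(2) unfolding 2(3)
            by (auto simp: right_ideal_def elim!: set_plus_elim)
          then show False using Suc.prems(3) by blast
        qed
        have lt: "right_order (I \<inter> J') < enat n"
          using Suc.IH[OF 2(1) right_ideal_Int[OF Suc.prems(2) J']] ne by blast
        then obtain m where m: "right_order (I \<inter> J') = enat m" "Suc m \<le> n"
          by (cases "right_order (I \<inter> J')") auto
        obtain e where e: "e * e = e" "I \<inter> J' = range ((*) e)"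
          using finite_order_idempotent[of "I \<inter> J'" m] m(1) by auto
        \<comment> \<open>The idempotent generating \<open>I \<inter> J'\<close> splits
          \<open>I\<close>, and \<open>T\<close> is the complement.\<close>
        define T where "T = (*) (1 - e) ` I"
        have eI: "e * a \<in> I \<inter> J'" for a using e(2) by blast
        have TI: "T \<subseteq> I"
        proof
          fix x assume "x \<in> T"
          then obtain a where "a \<in> I" "x = a - e * a" by (auto simp: T_def left_diff_distrib)
          then show "x \<in> I" using right_ideal_minus[OF Suc.prems(2)] eI by blast
        qed
        have TJ': "x = 0" if "x \<in> T" "x \<in> J'" for x
        proof -
          have "x \<in> range ((*) e)" using that TI e(2) by blast
          then have "e * x = x" using e(1) by (auto simp: mult.assoc[symmetric])
          moreover have "e * x = 0"
            using that(1) e(1) by (auto simp: T_def algebra_simps mult.assoc[symmetric])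
          ultimately show ?thesis by simp
        qed
        have I: "I = (I \<inter> J') + T"
        proof
          show "I \<subseteq> (I \<inter> J') + T"
          proof
            fix x assume "x \<in> I"
            moreover have "x = e * x + (1 - e) * x" by (simp add: algebra_simps)
            ultimately show "x \<in> (I \<inter> J') + T" using eI unfolding T_def by (metis image_eqI set_plus_intro)
          qed
          show "(I \<inter> J') + T \<subseteq> I"
            using TI Suc.prems(2) by (auto simp: right_ideal_def elim!: set_plus_elim)
        qed
        have T: "right_ideal T" unfolding T_def using right_ideal_image[OF Suc.prems(2)] .
        \<comment> \<open>\<open>T\<close> meets \<open>J'\<close> only in 0, so it embeds into
          \<open>J / J'\<close>, a copy of \<open>S\<close>. Concretely, for a nonzero
          \<open>L\<close> inside \<open>T\<close> the sum \<open>J' + L\<close> contains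
          \<open>S\<close>; removing the \<open>L\<close>-part from an element of \<open>T\<close>
          leaves an element of both \<open>T\<close> and \<open>J'\<close>, that is 0.\<close>
        have "T \<in> minimal_right_ideals"
          unfolding minimal_right_ideals_def
        proof (intro CollectI conjI allI impI T)
          show "T \<noteq> {0}"
            using I notI by (auto simp: set_plus_def)
          fix L assume L: "right_ideal L \<and> L \<subseteq> T"
          show "L = {0} \<or> L = T"
          proof (cases "L = {0}")
            case False
            then obtain l where l: "l \<in> L" "l \<noteq> 0" using L by (auto simp: right_ideal_def)
            obtain j s where js: "j \<in> J'" "s \<in> S" "l = j + s"
              using l(1) L TI Suc.prems(3) 2(3) by (blast elim: set_plus_elim)
            have "s \<noteq> 0" using js l TJ' L by auto
            moreover have "s \<in> (J' + L) \<inter> S"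
            proof -
              have "- j \<in> J'" using right_ideal_minus[OF J', of 0 j] js(1) J' by (simp add: right_ideal_def)
              then have "- j + l \<in> J' + L" using l(1) by (rule set_plus_intro)
              then show ?thesis using js by simp
            qed
            ultimately have S_sub: "S \<subseteq> J' + L"
              using S(3)[OF right_ideal_Int[OF right_ideal_plus[OF J'] S(1)], of L] L by blast
            have "T \<subseteq> L"
            proof
              fix t assume t: "t \<in> T"
              then obtain j1 s1 where 1: "j1 \<in> J'" "s1 \<in> S" "t = j1 + s1"
                using TI Suc.prems(3) 2(3) by (blast elim: set_plus_elim)
              then obtain j2 l2 where 2: "j2 \<in> J'" "l2 \<in> L" "s1 = j2 + l2"
                using S_sub by (blast elim: set_plus_elim)
              have "t - l2 \<in> T" using right_ideal_minus[OF T t] 2(2) L by blast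
              moreover have "t - l2 \<in> J'"
                using 1 2 J' by (simp add: right_ideal_def algebra_simps)
              ultimately show "t \<in> L" using TJ' 2(2) by fastforce
            qed
            then show ?thesis using L by blast
          qed simp
        qed
        then have "right_order I \<le> enat (Suc m)"
          using right_order_add_minimal[of "I \<inter> J'" m T] m(1) I by simp
        then show ?thesis using m(2) by (metis enat_ord_simps(1) le' order_trans)
      qed
    qed
  qed
qed

lemma right_order_strict_mono:
  fixes J :: "'a set"
  assumes "right_order J \<noteq> \<infinity>" "right_ideal I" "I \<subset> J"
  shows "right_order I < right_order J"
  using assms right_order_psubset[of J _ I] by (cases "right_order J") auto

lemma right_order_mono:
  fixes J :: "'a set"
  assumes "right_ideal I" "I \<subseteq> J"
  shows "right_order I \<le> right_order J"
proof (cases "I = J \<or> right_order J = \<infinity>")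
  case False
  then show ?thesis using right_order_strict_mono[of J I] assms by (simp add: less_imp_le psubset_eq)
qed auto

text \<open>Take \<open>M\<close> where the order is least among indices from \<open>k\<close> on:
  any later strict inclusion would lower it further.\<close>

lemma right_ideal_chain_stabilizes:
  fixes K :: "nat \<Rightarrow> 'a set"
  assumes "\<And>n. right_ideal (K n)" "\<And>n. K (Suc n) \<subseteq> K n" "right_order (K k) \<noteq> \<infinity>"
  obtains M where "k \<le> M" "\<And>m. M \<le> m \<Longrightarrow> K m = K M"
proof -
  obtain M where M: "k \<le> M" "\<And>m. k \<le> m \<Longrightarrow> right_order (K M) \<le> right_order (K m)"
    using exists_least_iff[of "\<lambda>r. \<exists>m\<ge>k. r = right_order (K m)"]
    by (metis linorder_not_le order_refl)
  have anti: "K m \<subseteq> K n" if "n \<le> m" for m n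
    using that assms(2) by (rule lift_Suc_antimono_le[rotated])
  have "right_order (K M) \<noteq> \<infinity>"
    using M(2)[of k] assms(3) by (cases "right_order (K M)") auto
  then have "K m = K M" if "M \<le> m" for m
    using right_order_strict_mono[of "K M" "K m"] anti[OF that] M(2)[of m] M(1) that assms(1)
    by (metis leD order_trans psubsetI)
  with M(1) show thesis by (rule that)
qed

section \<open>The socle of a semiprime ring\<close>

lemma add_closed_socle: "add_closed (socle :: 'a set)"
  unfolding socle_def using minimal_right_idealD(1) right_ideal_add_closed
  by (intro add_closed_ideal_sum) blast

lemma right_ideal_socle: "right_ideal (socle :: 'a set)"
  unfolding socle_def using minimal_right_idealD(1) by (intro right_ideal_ideal_sum)

text \<open>With this the socle is a two-sided ideal: left multiplication sends each minimal right
  ideal to \<open>{0}\<close> or to another minimal one.\<close>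

lemma socle_mult_left:
  fixes t :: 'a
  assumes "t \<in> socle"
  shows "r * t \<in> socle"
proof -
  have "S \<subseteq> {a. r * a \<in> socle}" if S: "S \<in> minimal_right_ideals" for S :: "'a set"
  proof (cases "(*) r ` S = {0}")
    case True
    then have "r * a = 0" if "a \<in> S" for a using that by blast
    then show ?thesis using add_closed_socle by (auto simp: add_closed_def)
  next
    case False
    then have "(*) r ` S \<in> minimal_right_ideals" by (rule minimal_right_ideal_image[OF S])
    then show ?thesis unfolding socle_def by (auto intro: ideal_sum_member)
  qed
  then have "socle \<subseteq> {a. r * a \<in> (socle::'a set)}"
    using right_ideal_vimage[OF right_ideal_socle, THEN right_ideal_add_closed]
    by (subst (1) socle_def) (rule ideal_sum_least)
  then show ?thesis using assms by blast
qed

lemma socle_finite_order: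
  fixes t :: 'a
  assumes "t \<in> socle"
  shows "right_order (range ((*) t)) \<noteq> \<infinity>"
proof -
  obtain \<G> f where G: "finite \<G>" "\<G> \<subseteq> minimal_right_ideals" "\<forall>J\<in>\<G>. f J \<in> J" "t = (\<Sum>J\<in>\<G>. f J)"
    using assms by (auto simp: socle_def ideal_sum_def)
  then have "t \<in> ideal_sum \<G>" by (auto simp: ideal_sum_def)
  moreover have "right_ideal (ideal_sum \<G>)"
    using G(2) minimal_right_idealD(1) by (intro right_ideal_ideal_sum) blast
  ultimately have "range ((*) t) \<subseteq> ideal_sum \<G>" by (auto simp: right_ideal_def)
  then have "right_order (range ((*) t)) \<le> right_order (ideal_sum \<G>)"
    by (intro right_order_mono right_ideal_range)
  also have "\<dots> \<le> enat (card \<G>)"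
    using G(1,2) right_order_le_iff by blast
  finally show ?thesis by (cases "right_order (range ((*) t))") auto
qed

text \<open>\<open>t A\<close> has finite order, so it equals \<open>e A\<close> for an idempotent
  \<open>e = t * z\<close>, and \<open>e * t = t\<close>.\<close>

lemma socle_regular:
  fixes t :: 'a
  assumes "t \<in> socle"
  obtains z where "t * z * t = t"
proof -
  obtain n where "right_order (range ((*) t)) \<le> enat n"
    using socle_finite_order[OF assms] by (cases "right_order (range ((*) t))") auto
  then obtain e where e: "e * e = e" "range ((*) t) = range ((*) e)"
    using finite_order_idempotent by blast
  have "e \<in> range ((*) t)" unfolding e(2) by (rule range_eqI[of _ _ 1]) simp
  then obtain z where z: "e = t * z" by blast
  have "t \<in> range ((*) e)" unfolding e(2)[symmetric] by (rule range_eqI[of _ _ 1]) simp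
  then have "e * t = t" using e(1) by (auto simp: mult.assoc[symmetric])
  then show thesis using that[of z] z by simp
qed

text \<open>McCoy's lemma: if \<open>y w y - y\<close> is von Neumann regular, then so is \<open>y\<close>.\<close>

lemma regular_mod_socle:
  fixes y :: 'a
  assumes "y * w * y - y \<in> socle"
  obtains v where "y * v * y = y"
proof -
  define t where "t = y * w * y - y"
  obtain z where z: "t * z * t = t" using socle_regular assms t_def by blast
  \<comment> \<open>Both \<open>y * (w * y - 1)\<close> and \<open>(y * w - 1) * y\<close> equal
    \<open>t\<close>, so \<open>y * v * y = y + t - t * z * t\<close>.\<close>
  define v where "v = w - (w * y - 1) * z * (y * w - 1)"
  have "y * v * y = y * w * y - (y * w * y - y) * z * (y * w * y - y)"
    by (simp add: v_def algebra_simps mult.assoc)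
  also have "\<dots> = y" using z by (simp add: t_def[symmetric]) (simp add: t_def)
  finally show thesis by (rule that)
qed

text \<open>The bridge from right to left ideals. Minimality of \<open>f A\<close> makes
  \<open>f A f\<close> a division ring, and semiprimeness moves any nonzero \<open>a\<close> in
  \<open>A f\<close> into it by a left multiplication; so every such \<open>a\<close> generates
  \<open>A f\<close>.\<close>

lemma minimal_left_ideal_idempotent:
  fixes f :: 'a
  assumes idem: "f * f = f" and min: "range ((*) f) \<in> minimal_right_ideals"
  shows "range (\<lambda>a. a * f) \<in> minimal_left_ideals"
proof -
  note R = minimal_right_idealD[OF min]
  have gen: "\<exists>c. u * c = f" if "f * u = u" "u \<noteq> 0" for u
  proof -
    have "u * c \<in> range ((*) f)" for c using that(1) by (metis mult.assoc rangeI)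
    then have "range ((*) u) \<subseteq> range ((*) f)" by blast
    moreover have "range ((*) u) \<noteq> {0}" using that(2) by (metis mult.right_neutral rangeI singletonD)
    ultimately have "range ((*) u) = range ((*) f)" using R(3)[OF right_ideal_range] by blast
    then show ?thesis using idem by (metis imageE rangeI)
  qed
  have f0: "f \<noteq> 0" using R(2) by auto
  have key: "\<exists>c. c * a = f" if a: "a * f = a" "a \<noteq> 0" for a
  proof -
    obtain r where r: "a * r * a \<noteq> 0" using semiprime[of a] a(2) by blast
    define u where "u = f * r * a"
    have "a * u = a * r * a" using a(1) by (simp add: u_def mult.assoc[symmetric])
    then have "u \<noteq> 0" using r by auto
    moreover have "f * u = u" using idem by (simp add: u_def mult.assoc[symmetric])
    moreover have "u * f = u" using a(1) by (simp add: u_def mult.assoc)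
    ultimately have u: "u \<noteq> 0" "f * u = u" "u * f = u" by blast+
    obtain c where c: "u * c = f" using gen u by blast
    \<comment> \<open>Compressing \<open>c\<close> puts the right inverse of \<open>u\<close> into
      \<open>f A f\<close>. There \<open>v\<close> has a right inverse \<open>w\<close> as well,
      which forces \<open>v * u = f\<close>.\<close>
    define v where "v = f * c * f"
    have v: "u * v = f" "f * v = v" "v * f = v"
      using c u(3) idem by (simp_all add: v_def mult.assoc[symmetric]) (simp add: mult.assoc idem)
    have "v \<noteq> 0" using v(1) f0 by auto
    then obtain w where w: "v * w = f" using gen v(2) by blast
    have "u * f = f * w" by (metis mult.assoc v(1) w)
    then have "v * u = f" by (metis u(3) mult.assoc v(3) w)
    then have "(v * f * r) * a = f" by (simp add: u_def mult.assoc)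
    then show ?thesis by blast
  qed
  show ?thesis
    unfolding minimal_left_ideals_def
  proof (intro CollectI conjI allI impI)
    show "left_ideal (range (\<lambda>a. a * f))"
      unfolding left_ideal_def
    proof (intro conjI ballI allI)
      show "0 \<in> range (\<lambda>a. a * f)" by (rule range_eqI[of _ _ 0]) simp
      show "x + y \<in> range (\<lambda>a. a * f)" if "x \<in> range (\<lambda>a. a * f)" "y \<in> range (\<lambda>a. a * f)" for x y
        using that by (auto simp: distrib_right[symmetric])
      show "r * x \<in> range (\<lambda>a. a * f)" if "x \<in> range (\<lambda>a. a * f)" for x r
        using that by (auto simp: mult.assoc[symmetric])
    qed
    show "range (\<lambda>a. a * f) \<noteq> {0}" using f0 idem by (metis rangeI singletonD)
    fix I assume I: "left_ideal I \<and> I \<subseteq> range (\<lambda>a. a * f)"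
    show "I = {0} \<or> I = range (\<lambda>a. a * f)"
    proof (cases "I = {0}")
      case False
      then obtain a where a: "a \<in> I" "a \<noteq> 0" using I by (auto simp: left_ideal_def)
      have "a * f = a" using a(1) I idem by (auto simp: mult.assoc)
      then obtain c where "c * a = f" using key a(2) by blast
      then have "f \<in> I" using a(1) I by (auto simp: left_ideal_def)
      then have "range (\<lambda>a. a * f) \<subseteq> I" using I by (auto simp: left_ideal_def)
      then show ?thesis using I by blast
    qed simp
  qed
qed

end

section \<open>Two-sided ideals\<close>

lemma ring_ring_of_type_algebra: "ring (ring_of_type_algebra :: 'a::ring_1 ring)"
proof -
  have "\<exists>y. x + y = 0" for x :: 'a
    by (rule exI[of _ "- x"]) simp
  moreover have "\<exists>y. y + x = 0" for x :: 'a
    by (rule exI[of _ "- x"]) simp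
  ultimately show ?thesis
    unfolding ring_of_type_algebra_def
    by unfold_locales (auto simp: algebra_simps Units_def)
qed

lemma ideal_ring_of_type_algebraI:
  fixes I :: "'a::ring_1 set"
  assumes "0 \<in> I" "\<And>a b. a \<in> I \<Longrightarrow> b \<in> I \<Longrightarrow> a + b \<in> I"
    "\<And>a r. a \<in> I \<Longrightarrow> r * a \<in> I" "\<And>a r. a \<in> I \<Longrightarrow> a * r \<in> I"
  shows "ideal I ring_of_type_algebra"
proof (rule idealI[OF ring_ring_of_type_algebra])
  interpret R: ring "ring_of_type_algebra :: 'a ring" by (rule ring_ring_of_type_algebra)
  show "subgroup I (add_monoid (ring_of_type_algebra :: 'a ring))"
  proof (rule R.add.subgroupI)
    show "I \<noteq> {}" using assms(1) by blast
    fix a b :: 'a assume ab: "a \<in> I" "b \<in> I"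
    then show "a \<oplus>\<^bsub>ring_of_type_algebra\<^esub> b \<in> I"
      using assms(2) by (simp add: ring_of_type_algebra_def)
    have "- a \<in> I" using assms(4)[OF ab(1), of "- 1"] by simp
    moreover have "\<ominus>\<^bsub>ring_of_type_algebra\<^esub> a = - a"
      by (rule R.minus_equality) (simp_all add: ring_of_type_algebra_def)
    ultimately show "\<ominus>\<^bsub>ring_of_type_algebra\<^esub> a \<in> I" by simp
  qed (simp add: ring_of_type_algebra_def)
qed (use assms(3,4) in \<open>simp_all add: ring_of_type_algebra_def\<close>)

text \<open>If \<open>xAx = 0\<close>, then the two-sided ideal generated by \<open>x\<close> squares to zero.\<close>

lemma semiprime_ring_imp_semiprime_type:
  assumes "semiprime_ring (ring_of_type_algebra :: 'a::ring_1 ring)"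
  shows "semiprime_type TYPE('a)"
proof
  fix x :: 'a assume x: "x * r * x = 0" for r
  interpret R: ring "ring_of_type_algebra :: 'a ring" by (rule ring_ring_of_type_algebra)
  define J where "J = genideal (ring_of_type_algebra :: 'a ring) {x}"
  have J: "ideal J ring_of_type_algebra" and xJ: "x \<in> J"
    unfolding J_def using R.genideal_ideal[of "{x}"] R.genideal_self[of "{x}"]
    by (auto simp: ring_of_type_algebra_def)
  have least: "J \<subseteq> I" if "ideal I ring_of_type_algebra" "x \<in> I" for I
    unfolding J_def using that by (intro R.genideal_minimal) auto
  \<comment> \<open>The elements of \<open>J\<close> are never described explicitly: minimality is
    used against two annihilator ideals in turn, first with \<open>x\<close> on the left, then with
    all of \<open>J\<close>. Taking \<open>r = 1\<close> gives the plain products.\<close>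
  have "J \<subseteq> {y. \<forall>r. x * r * y = 0}"
  proof (rule least[OF ideal_ring_of_type_algebraI])
    show "a * s \<in> {y. \<forall>r. x * r * y = 0}" if "a \<in> {y. \<forall>r. x * r * y = 0}" for a s
      using that by (simp add: mult.assoc[symmetric])
    show "s * a \<in> {y. \<forall>r. x * r * y = 0}" if "a \<in> {y. \<forall>r. x * r * y = 0}" for a s
      using that mult.assoc[of x _ s] by (simp add: mult.assoc[of _ s a, symmetric])
  qed (use x in \<open>auto simp: distrib_left\<close>)
  then have "J \<subseteq> {z. \<forall>y\<in>J. \<forall>r. z * r * y = 0}"
  proof (intro least[OF ideal_ring_of_type_algebraI])
    show "a * s \<in> {z. \<forall>y\<in>J. \<forall>r. z * r * y = 0}" if "a \<in> {z. \<forall>y\<in>J. \<forall>r. z * r * y = 0}" for a s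
      using that by (simp add: mult.assoc[of a s])
    show "s * a \<in> {z. \<forall>y\<in>J. \<forall>r. z * r * y = 0}" if "a \<in> {z. \<forall>y\<in>J. \<forall>r. z * r * y = 0}" for a s
      using that by (simp add: mult.assoc)
  qed (auto simp: distrib_right)
  then have "a * 1 * b = 0" if "a \<in> J" "b \<in> J" for a b
    using that by blast
  then have JJ: "a * b = 0" if "a \<in> J" "b \<in> J" for a b
    using that by simp
  have "ideal_prod ring_of_type_algebra J J = {0}"
  proof
    show "ideal_prod ring_of_type_algebra J J \<subseteq> {0}"
    proof
      fix a assume "a \<in> ideal_prod ring_of_type_algebra J J"
      then show "a \<in> {0}"
        by (induction rule: ideal_prod.induct) (auto simp: ring_of_type_algebra_def JJ)
    qed
    show "{0} \<subseteq> ideal_prod ring_of_type_algebra J J"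
      using ideal_prod.prod[OF xJ xJ, of ring_of_type_algebra] JJ[OF xJ xJ]
      by (simp add: ring_of_type_algebra_def)
  qed
  moreover have "\<zero>\<^bsub>ring_of_type_algebra\<^esub> = (0::'a)" by (simp add: ring_of_type_algebra_def)
  ultimately have "J = {0}"
    using assms J unfolding semiprime_ring_def by metis
  then show "x = 0" using xJ by blast
qed

section \<open>Congruence modulo the socle\<close>

text \<open>Equality in the quotient, expressed on representatives so that computations need no
  cosets.\<close>

definition socle_cong :: "'a::ring_1 \<Rightarrow> 'a \<Rightarrow> bool" (infix \<open>\<approx>\<^sub>s\<close> 50) where
  "a \<approx>\<^sub>s b \<longleftrightarrow> a - b \<in> socle"

context semiprime_type
begin

lemma socle_mult_right: "t \<in> socle \<Longrightarrow> t * r \<in> (socle :: 'a set)"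
  using right_ideal_socle by (simp add: right_ideal_def)

lemma socle_cong_refl [simp]: "(a::'a) \<approx>\<^sub>s a"
  using add_closed_socle by (simp add: socle_cong_def add_closed_def)

lemma socle_cong_sym:
  assumes "(a::'a) \<approx>\<^sub>s b"
  shows "b \<approx>\<^sub>s a"
proof -
  have "(a - b) * (- 1) \<in> socle" using assms socle_mult_right unfolding socle_cong_def by blast
  then show ?thesis by (simp add: socle_cong_def)
qed

lemma socle_cong_trans [trans]:
  assumes "(a::'a) \<approx>\<^sub>s b" "b \<approx>\<^sub>s c"
  shows "a \<approx>\<^sub>s c"
proof -
  have "(a - b) + (b - c) \<in> socle"
    using assms add_closed_socle unfolding socle_cong_def add_closed_def by blast
  then show ?thesis by (simp add: socle_cong_def)
qed

lemma socle_cong_mult: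
  assumes "(a::'a) \<approx>\<^sub>s b" "c \<approx>\<^sub>s d"
  shows "a * c \<approx>\<^sub>s b * d"
proof -
  have "(a - b) * c \<in> socle" "b * (c - d) \<in> socle"
    using assms socle_mult_right socle_mult_left by (auto simp: socle_cong_def)
  then have "(a - b) * c + b * (c - d) \<in> socle"
    using add_closed_socle by (auto simp: add_closed_def)
  then show ?thesis by (simp add: socle_cong_def algebra_simps)
qed

lemmas socle_cong_mult_left = socle_cong_mult[OF socle_cong_refl]
lemmas socle_cong_mult_right = socle_cong_mult[OF _ socle_cong_refl]

lemma socle_cong_diff:
  assumes "(a::'a) \<approx>\<^sub>s b" "c \<approx>\<^sub>s d"
  shows "a - c \<approx>\<^sub>s b - d"
  using right_ideal_minus[OF right_ideal_socle, of "a - b" "c - d"] assms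
  by (simp add: socle_cong_def algebra_simps)

lemma ideal_socle: "ideal socle (ring_of_type_algebra :: 'a ring)"
  using add_closed_socle
  by (intro ideal_ring_of_type_algebraI) (auto simp: add_closed_def socle_mult_left socle_mult_right)

abbreviation coset :: "'a \<Rightarrow> 'a set" where
  "coset \<equiv> a_r_coset ring_of_type_algebra socle"

abbreviation quotient :: "'a set ring" where
  "quotient \<equiv> ring_of_type_algebra Quot socle"

lemma coset_eq_iff: "coset a = coset b \<longleftrightarrow> a \<approx>\<^sub>s b"
proof -
  have coset: "coset c = {h + c | h. h \<in> socle}" for c
    by (auto simp: a_r_coset_def r_coset_def ring_of_type_algebra_def)
  show ?thesis
  proof
    assume eq: "coset a = coset b"
    have "a \<in> coset a" using add_closed_socle by (auto simp: coset add_closed_def)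
    then show "a \<approx>\<^sub>s b" unfolding eq by (auto simp: coset socle_cong_def)
  next
    assume "a \<approx>\<^sub>s b"
    then have ab: "a - b \<in> socle" "b - a \<in> socle"
      using socle_cong_sym by (auto simp: socle_cong_def)
    have "coset c \<subseteq> coset d" if "c - d \<in> socle" for c d
    proof
      fix y assume "y \<in> coset c"
      then obtain h where "h \<in> socle" "y = h + c" by (auto simp: coset)
      then have "h + (c - d) \<in> socle" "y = (h + (c - d)) + d"
        using that add_closed_socle by (auto simp: add_closed_def)
      then show "y \<in> coset d" unfolding coset by blast
    qed
    then show "coset a = coset b" using ab by blast
  qed
qed

lemma coset_mult: "coset a \<otimes>\<^bsub>quotient\<^esub> coset b = coset (a * b)"
  using ideal.rcoset_mult_add[OF ideal_socle, of a b]
  by (simp add: FactRing_def ring_of_type_algebra_def)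

lemma coset_one: "\<one>\<^bsub>quotient\<^esub> = coset 1"
  by (simp add: FactRing_def ring_of_type_algebra_def)

lemma coset_power: "coset a [^]\<^bsub>quotient\<^esub> (n::nat) = coset (a ^ n)"
proof (induction n)
  case (Suc n)
  then show ?case by (simp add: nat_pow_def coset_mult power_commutes)
qed (simp add: nat_pow_def coset_one)

lemma carrier_quotient: "carrier quotient = range coset"
  by (auto simp: FactRing_def A_RCOSETS_def' ring_of_type_algebra_def)

text \<open>Left and right inverses may come from unrelated formulas, as they do for the
  perturbation: \<open>d\<close> is congruent to \<open>d * x * c\<close>, and this to
  \<open>c\<close>.\<close>

lemma fredholmI:
  assumes "x * c \<approx>\<^sub>s 1" "d * x \<approx>\<^sub>s (1::'a)"
  shows "fredholm x"
proof -
  have "d \<approx>\<^sub>s d * (x * c)"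
    using socle_cong_mult_left[OF assms(1), of d] by (simp add: socle_cong_sym)
  also have "d * (x * c) \<approx>\<^sub>s c"
    using socle_cong_mult_right[OF assms(2), of c] by (simp add: mult.assoc)
  finally have "d * x \<approx>\<^sub>s c * x" by (rule socle_cong_mult_right)
  then have "c * x \<approx>\<^sub>s 1" using assms(2) socle_cong_sym socle_cong_trans by blast
  then show ?thesis
    using assms(1) unfolding fredholm_def Units_def
    by (auto simp: carrier_quotient coset_mult coset_one coset_eq_iff)
qed

lemma b_fredholmE:
  fixes x :: 'a
  assumes "b_fredholm x"
  obtains b k where "x * b \<approx>\<^sub>s b * x" "b * x * b \<approx>\<^sub>s b" "x ^ k * b * x \<approx>\<^sub>s x ^ k"
proof -
  obtain B k where B: "B \<in> carrier quotient"
      "B \<otimes>\<^bsub>quotient\<^esub> coset x \<otimes>\<^bsub>quotient\<^esub> B = B"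
      "coset x \<otimes>\<^bsub>quotient\<^esub> B = B \<otimes>\<^bsub>quotient\<^esub> coset x"
      "(coset x [^]\<^bsub>quotient\<^esub> (k::nat)) \<otimes>\<^bsub>quotient\<^esub> B \<otimes>\<^bsub>quotient\<^esub> coset x = coset x [^]\<^bsub>quotient\<^esub> k"
    using assms unfolding b_fredholm_def drazin_invertible_def by blast
  obtain b where "B = coset b" using B(1) by (auto simp: carrier_quotient)
  with B show thesis
    by (intro that) (simp_all add: coset_mult coset_power coset_eq_iff)
qed

lemma socle_cong_power_commute:
  fixes x b :: 'a
  assumes comm: "x * b \<approx>\<^sub>s b * x"
  shows "x ^ i * b \<approx>\<^sub>s b * x ^ i"
proof (induction i)
  case (Suc i)
  have "x ^ Suc i * b = x * (x ^ i * b)" by (simp add: mult.assoc)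
  also have "\<dots> \<approx>\<^sub>s x * (b * x ^ i)" by (rule socle_cong_mult_left[OF Suc])
  also have "\<dots> = (x * b) * x ^ i" by (simp add: mult.assoc)
  also have "\<dots> \<approx>\<^sub>s (b * x) * x ^ i" by (rule socle_cong_mult_right[OF comm])
  also have "\<dots> = b * x ^ Suc i" by (simp add: mult.assoc)
  finally show ?case .
qed simp

text \<open>The inverse modulo the socle is \<open>b ^ n\<close>: the hypothesis \<open>left\<close>
  telescopes to \<open>b ^ n * x ^ (n + n)\<close> congruent to \<open>x ^ n\<close>, commuting
  moves one \<open>x ^ n\<close> to the front, and regularity lifts from the quotient.\<close>

lemma power_regular:
  fixes x b :: 'a
  assumes comm: "x * b \<approx>\<^sub>s b * x" and left: "b * x ^ Suc k \<approx>\<^sub>s x ^ k" and n: "k \<le> n"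
  obtains w where "x ^ n * w * x ^ n = x ^ n"
proof -
  have left': "b * x ^ Suc m \<approx>\<^sub>s x ^ m" if "k \<le> m" for m
    using socle_cong_mult_right[OF left, of "x ^ (m - k)"] that
    by (simp add: mult.assoc power_add[symmetric])
  have pow: "b ^ j * x ^ (n + j) \<approx>\<^sub>s x ^ n" for j
  proof (induction j)
    case (Suc j)
    have "b ^ Suc j * x ^ (n + Suc j) = b ^ j * (b * x ^ Suc (n + j))"
      by (simp only: power_Suc2 mult.assoc add_Suc_right)
    also have "\<dots> \<approx>\<^sub>s b ^ j * x ^ (n + j)"
      using n by (intro socle_cong_mult_left left') simp
    also note Suc
    finally show ?case .
  qed simp
  have comm2: "x ^ i * b ^ j \<approx>\<^sub>s b ^ j * x ^ i" for i j
  proof (induction j)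
    case (Suc j)
    have "x ^ i * b ^ Suc j = (x ^ i * b) * b ^ j" by (simp add: mult.assoc)
    also have "\<dots> \<approx>\<^sub>s (b * x ^ i) * b ^ j" by (rule socle_cong_mult_right[OF socle_cong_power_commute[OF comm]])
    also have "\<dots> = b * (x ^ i * b ^ j)" by (simp add: mult.assoc)
    also have "\<dots> \<approx>\<^sub>s b * (b ^ j * x ^ i)" by (rule socle_cong_mult_left[OF Suc])
    also have "\<dots> = b ^ Suc j * x ^ i" by (simp add: mult.assoc)
    finally show ?case .
  qed simp
  have "x ^ n * b ^ n * x ^ n \<approx>\<^sub>s b ^ n * x ^ n * x ^ n"
    by (rule socle_cong_mult_right[OF comm2])
  also have "\<dots> = b ^ n * x ^ (n + n)" by (simp add: power_add mult.assoc)
  also note pow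
  finally have "x ^ n * b ^ n * x ^ n - x ^ n \<in> socle" by (simp add: socle_cong_def)
  then obtain w where "x ^ n * w * x ^ n = x ^ n" by (rule regular_mod_socle)
  then show thesis by (rule that)
qed

text \<open>An element \<open>a = x\<^sup>k c\<close> annihilated by \<open>x\<close> equals \<open>(x\<^sup>k - b x\<^sup>k\<^sup>+\<^sup>1) c\<close>, so the intersections
  eventually lie in a right ideal of finite order.\<close>

lemma annihilator_range_stabilizes:
  fixes x b :: 'a
  assumes "b * x ^ Suc k \<approx>\<^sub>s x ^ k"
  obtains M where "k \<le> M"
    "\<And>m. M \<le> m \<Longrightarrow> right_annihilator x \<inter> range ((*) (x ^ m)) = right_annihilator x \<inter> range ((*) (x ^ M))"
proof -
  define K where "K = (\<lambda>n. right_annihilator x \<inter> range ((*) (x ^ n)))"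
  define t where "t = x ^ k - b * x ^ Suc k"
  have K: "right_ideal (K n)" for n
    by (simp add: K_def right_ideal_Int right_ideal_annihilator right_ideal_range)
  have dec: "K (Suc n) \<subseteq> K n" for n
    by (auto simp: K_def power_Suc2 mult.assoc simp del: power_Suc)
  have "K k \<subseteq> range ((*) t)"
  proof
    fix a assume "a \<in> K k"
    then obtain c where c: "a = x ^ k * c" "x * a = 0" by (auto simp: K_def right_annihilator_def)
    have "t * c = a - b * (x * a)" by (simp add: t_def c(1) left_diff_distrib mult.assoc)
    then have "a = t * c" using c(2) by simp
    then show "a \<in> range ((*) t)" by blast
  qed
  then have "right_order (K k) \<le> right_order (range ((*) t))" by (rule right_order_mono[OF K])
  moreover have "t \<in> socle" using socle_cong_sym[OF assms] by (simp add: t_def socle_cong_def)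
  then have "right_order (range ((*) t)) \<noteq> \<infinity>" by (rule socle_finite_order)
  ultimately have fin: "right_order (K k) \<noteq> \<infinity>" by (cases "right_order (K k)") auto
  obtain M where M: "k \<le> M" "\<And>m. M \<le> m \<Longrightarrow> K m = K M"
    by (rule right_ideal_chain_stabilizes[OF K dec fin]) blast
  show thesis by (rule that[OF M(1)]) (rule M(2)[unfolded K_def])
qed

end

section \<open>The kernel of a perturbation\<close>

text \<open>On \<open>D = \<Inter>\<^sub>n x\<^sup>n A\<close> the element \<open>s = x\<^sup>M w\<close> is a right inverse of \<open>x\<close> that maps \<open>D\<close> into itself, because
  \<open>R(x) \<inter> x\<^sup>M A \<subseteq> D\<close>; hence multiplication by \<open>1 - z s\<close> carries \<open>R(x - z)\<close> onto \<open>R(x) \<inter> x\<^sup>M A\<close>.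
  The hypothesis \<open>limit\<close> says that \<open>v\<close> behaves like a limit of polynomials in \<open>s\<close>, and replaces the
  topology, so that the lemma also applies in the opposite ring.\<close>

lemma right_annihilator_perturbation:
  fixes x w z z' v :: "'a::ring_1"
  assumes reg: "x ^ Suc M * w * x ^ Suc M = x ^ Suc M"
    and stab: "\<And>m. M \<le> m \<Longrightarrow>
      right_annihilator x \<inter> range ((*) (x ^ m)) = right_annihilator x \<inter> range ((*) (x ^ M))"
    and central: "\<And>a. z * a = a * z" and z: "z * z' = 1"
    and limit: "\<And>p a. (\<And>n. p * (x ^ M * w) ^ n * a = 0) \<Longrightarrow> p * v * a = 0"
    and v: "v * (1 - z * (x ^ M * w)) = 1" "(1 - z * (x ^ M * w)) * v = 1"
  shows "right_annihilator (x - z) = (*) v ` (right_annihilator x \<inter> range ((*) (x ^ M)))"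
proof -
  define s where "s = x ^ M * w"
  define u where "u = 1 - z * s"
  define D where "D = (\<Inter>m\<in>{M..}. range ((*) (x ^ m)))"
  define K where "K = right_annihilator x \<inter> range ((*) (x ^ M))"
  have z': "z' * z = 1" using central[of z'] z by simp
  have K: "K = right_annihilator x \<inter> D"
  proof
    show "K \<subseteq> right_annihilator x \<inter> D"
    proof
      fix a assume a: "a \<in> K"
      have "a \<in> range ((*) (x ^ m))" if "M \<le> m" for m
        using a stab[OF that] unfolding K_def by blast
      then show "a \<in> right_annihilator x \<inter> D" using a by (simp add: D_def K_def)
    qed
    show "right_annihilator x \<inter> D \<subseteq> K" unfolding K_def D_def by blast
  qed
  \<comment> \<open>Here the exponent \<open>Suc M\<close> matters:
    \<open>x * s = x ^ Suc M * w\<close>, and \<open>a\<close> is a multiple of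
    \<open>x ^ Suc M\<close>.\<close>
  have xs: "x * s * a = a" if a: "a \<in> D" for a
  proof -
    have "Suc M \<in> {M..}" by simp
    then obtain c where c: "a = x ^ Suc M * c" using a unfolding D_def by blast
    have "x * s * x ^ Suc M = x ^ Suc M" using reg by (simp add: s_def mult.assoc)
    then show ?thesis unfolding c by (simp only: mult.assoc[symmetric])
  qed
  have D_diff: "a - b \<in> D" if "a \<in> D" "b \<in> D" for a b
    using that by (auto simp: D_def intro: right_ideal_minus[OF right_ideal_range])
  have zD: "z * a \<in> D" if a: "a \<in> D" for a
    unfolding D_def
  proof
    fix m assume "m \<in> {M..}"
    then have "a \<in> range ((*) (x ^ m))" using a unfolding D_def by blast
    then have "a * z \<in> range ((*) (x ^ m))"
      using right_ideal_range[of "x ^ m"] unfolding right_ideal_def by blast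
    then show "z * a \<in> range ((*) (x ^ m))" using central[of a] by simp
  qed
  \<comment> \<open>Writing \<open>a = x ^ Suc m * c\<close>, both \<open>s * a\<close> and
    \<open>x ^ m * c\<close> are mapped to \<open>a\<close> by \<open>x\<close>. Their difference
    lies in \<open>K\<close>, hence in \<open>x ^ m A\<close> by stability.\<close>
  have sD: "s * a \<in> D" if a: "a \<in> D" for a
    unfolding D_def
  proof
    fix m assume "m \<in> {M..}"
    then have m: "M \<le> m" by simp
    have "Suc m \<in> {M..}" using m by simp
    then obtain c where c: "a = x ^ Suc m * c" using a unfolding D_def by blast
    have "s * a = x ^ M * (w * a)" by (simp add: s_def mult.assoc)
    then have "s * a \<in> range ((*) (x ^ M))" by blast
    moreover have "x ^ m * c = x ^ M * (x ^ (m - M) * c)"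
      using m by (simp add: mult.assoc[symmetric] power_add[symmetric])
    then have "x ^ m * c \<in> range ((*) (x ^ M))" by blast
    ultimately have "s * a - x ^ m * c \<in> range ((*) (x ^ M))"
      by (rule right_ideal_minus[OF right_ideal_range])
    moreover have "x * (s * a - x ^ m * c) = 0"
      using xs[OF a] c by (simp add: right_diff_distrib mult.assoc)
    ultimately have "s * a - x ^ m * c \<in> K" by (simp add: K_def right_annihilator_def)
    then have "s * a - x ^ m * c \<in> range ((*) (x ^ m))" using stab[OF m] unfolding K_def by blast
    then obtain d where "s * a - x ^ m * c = x ^ m * d" by blast
    then have "s * a = x ^ m * (c + d)" by (simp add: algebra_simps)
    then show "s * a \<in> range ((*) (x ^ m))" by blast
  qed
  have u_to: "u * y \<in> K" if "y \<in> right_annihilator (x - z)" for y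
  proof -
    have xy: "x * y = z * y" using that by (simp add: right_annihilator_def left_diff_distrib)
    \<comment> \<open>As \<open>z'\<close> is central, this identity can be iterated and puts
      \<open>y\<close> into every \<open>x ^ m A\<close>.\<close>
    have y: "y = x * (z' * y)"
    proof -
      have "x * (z' * y) = z' * (z * (x * (z' * y)))" by (simp add: mult.assoc[symmetric] z')
      also have "\<dots> = z' * (x * (z * z' * y))" by (metis central mult.assoc)
      also have "\<dots> = y" using z z' xy by (simp add: mult.assoc[symmetric])
      finally show ?thesis ..
    qed
    have z'_central: "z' * a = a * z'" for a
      by (metis central mult.assoc mult.left_neutral mult.right_neutral z z')
    have "y \<in> range ((*) (x ^ m))" for m
    proof (induction m)
      case (Suc m)
      then obtain c where c: "y = x ^ m * c" by blast
      have "z' * y = x ^ m * (c * z')" unfolding c by (simp add: z'_central mult.assoc)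
      then have "y = x ^ Suc m * (c * z')" using y by (simp add: mult.assoc)
      then show ?case by blast
    qed simp
    then have yD: "y \<in> D" unfolding D_def by blast
    have "u * y = y - z * (s * y)" by (simp add: u_def algebra_simps mult.assoc)
    moreover have "x * (y - z * (s * y)) = 0"
    proof -
      have "x * (z * (s * y)) = z * (x * s * y)" by (metis central mult.assoc)
      then show ?thesis using xs[OF yD] xy by (simp add: right_diff_distrib)
    qed
    moreover have "y - z * (s * y) \<in> D" using yD by (intro D_diff zD sD)
    ultimately show ?thesis by (simp add: K right_annihilator_def)
  qed
  have vK: "v * a \<in> right_annihilator (x - z)" if a: "a \<in> K" for a
  proof -
    \<comment> \<open>What is carried over to \<open>v * a\<close> is the equation
      \<open>x * s * a = a\<close>, which survives limits, instead of membership in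
      \<open>D\<close>.\<close>
    have "s ^ n * a \<in> D" for n
      by (induction n) (use a K sD in \<open>simp_all add: mult.assoc\<close>)
    then have "(x * s - 1) * (s ^ n * a) = 0" for n
      using xs by (simp add: left_diff_distrib)
    then have "(x * s - 1) * v * a = 0"
      using limit[of "x * s - 1" a] by (simp add: s_def mult.assoc)
    then have xsva: "x * s * (v * a) = v * a" by (simp add: left_diff_distrib mult.assoc)
    have "u * (v * a) = a" using v(2) by (simp add: u_def s_def mult.assoc[symmetric])
    then have va: "v * a = a + z * (s * (v * a))" by (simp add: u_def algebra_simps mult.assoc)
    have "x * (v * a) = x * a + x * (z * (s * (v * a)))"
      by (subst va) (simp only: distrib_left)
    also have "x * a = 0" using a by (simp add: K right_annihilator_def)
    also have "x * (z * (s * (v * a))) = z * (x * s * (v * a))" using central by (metis mult.assoc)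
    finally show ?thesis using xsva by (simp add: right_annihilator_def left_diff_distrib)
  qed
  show ?thesis
    unfolding K_def[symmetric]
  proof
    show "right_annihilator (x - z) \<subseteq> (*) v ` K"
    proof
      fix y assume "y \<in> right_annihilator (x - z)"
      then have "u * y \<in> K" by (rule u_to)
      moreover have "y = v * (u * y)" using v(1) by (simp add: u_def s_def mult.assoc[symmetric])
      ultimately show "y \<in> (*) v ` K" by blast
    qed
  qed (use vK in blast)
qed

lemma right_order_image_left_invertible:
  assumes "u * v = 1"
  shows "right_order ((*) v ` J) = right_order J"
proof (rule antisym[OF right_order_image_le])
  have "(*) u ` (*) v ` J = J"
    using assms by (simp add: image_image mult.assoc[symmetric])
  then show "right_order J \<le> right_order ((*) v ` J)"
    using right_order_image_le[of u "(*) v ` J"] by simp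
qed

section \<open>The opposite ring\<close>

text \<open>A separate type, because ideals, order and nullity take their multiplication from the
  type class; left-sided statements become right-sided ones at this type.\<close>

typedef 'a opposite = "UNIV :: 'a set" morphisms of_opposite to_opposite
  by simp

setup_lifting type_definition_opposite

instantiation opposite :: (ring_1) ring_1
begin

lift_definition zero_opposite :: "'a opposite" is 0 .
lift_definition one_opposite :: "'a opposite" is 1 .
lift_definition plus_opposite :: "'a opposite \<Rightarrow> 'a opposite \<Rightarrow> 'a opposite" is "(+)" .
lift_definition minus_opposite :: "'a opposite \<Rightarrow> 'a opposite \<Rightarrow> 'a opposite" is "(-)" .
lift_definition uminus_opposite :: "'a opposite \<Rightarrow> 'a opposite" is uminus .
lift_definition times_opposite :: "'a opposite \<Rightarrow> 'a opposite \<Rightarrow> 'a opposite" is "\<lambda>a b. b * a" .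

instance
  by standard (transfer; simp add: algebra_simps)+

end

lemma to_opposite_zero: "to_opposite 0 = 0"
  by (simp add: zero_opposite_def)

lemma to_opposite_one: "to_opposite 1 = 1"
  by (simp add: one_opposite_def)

lemma to_opposite_add: "to_opposite a + to_opposite b = to_opposite (a + b)"
  by (simp add: plus_opposite_def to_opposite_inverse)

lemma to_opposite_diff: "to_opposite a - to_opposite b = to_opposite (a - b)"
  by (simp add: minus_opposite_def to_opposite_inverse)

lemma to_opposite_mult: "to_opposite a * to_opposite b = to_opposite (b * a)"
  by (simp add: times_opposite_def to_opposite_inverse)

lemma to_opposite_power: "to_opposite a ^ n = to_opposite (a ^ n)"
  by (induction n) (simp_all add: to_opposite_one to_opposite_mult power_commutes)

lemma to_opposite_eq_iff [simp]: "to_opposite a = to_opposite b \<longleftrightarrow> a = b"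
  by (simp add: to_opposite_inject)

lemma to_opposite_eq_zero_iff [simp]: "to_opposite a = 0 \<longleftrightarrow> a = 0"
  by (simp add: to_opposite_zero[symmetric])

lemma inj_to_opposite: "inj to_opposite"
  by (simp add: inj_on_def)

lemma surj_to_opposite: "surj to_opposite"
  by (metis of_opposite_inverse surjI)

lemma to_opposite_mem_image [simp]: "to_opposite a \<in> to_opposite ` J \<longleftrightarrow> a \<in> J"
  by auto

lemma zero_mem_to_opposite_image [simp]: "0 \<in> to_opposite ` J \<longleftrightarrow> 0 \<in> J"
  by (simp add: to_opposite_zero[symmetric])

lemma all_opposite: "(\<forall>r. P r) \<longleftrightarrow> (\<forall>r. P (to_opposite r))"
  by (metis of_opposite_inverse)

lemma surj_image_to_opposite: "surj ((`) to_opposite)"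
  by (metis image_f_inv_f surjI surj_to_opposite)

lemma all_opposite_set: "(\<forall>I. P I) \<longleftrightarrow> (\<forall>I. P (to_opposite ` I))"
  by (metis surj_image_to_opposite surjD)

lemma right_ideal_to_opposite_iff: "right_ideal (to_opposite ` J) \<longleftrightarrow> left_ideal J"
  by (simp add: right_ideal_def left_ideal_def all_opposite to_opposite_add to_opposite_mult)

lemma to_opposite_image_eq_iff: "to_opposite ` I = to_opposite ` J \<longleftrightarrow> I = J"
  by (rule inj_image_eq_iff[OF inj_to_opposite])

lemma to_opposite_image_eq_zero_iff: "to_opposite ` I = {0} \<longleftrightarrow> I = {0}"
  using to_opposite_image_eq_iff[of I "{0}"] by (simp add: to_opposite_zero)

lemma to_opposite_image_subset_iff: "to_opposite ` I \<subseteq> to_opposite ` J \<longleftrightarrow> I \<subseteq> J"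
  by (rule inj_image_subset_iff[OF inj_to_opposite])

lemma minimal_to_opposite_iff:
  "to_opposite ` J \<in> minimal_right_ideals \<longleftrightarrow> J \<in> minimal_left_ideals"
  unfolding minimal_right_ideals_def minimal_left_ideals_def mem_Collect_eq
  by (subst all_opposite_set)
    (simp add: right_ideal_to_opposite_iff to_opposite_image_eq_iff to_opposite_image_eq_zero_iff
      to_opposite_image_subset_iff)

lemma minimal_right_ideals_opposite:
  "(minimal_right_ideals :: 'a::ring_1 opposite set set) = (`) to_opposite ` minimal_left_ideals"
  (is "?A = ?B")
proof
  show "?A \<subseteq> ?B"
  proof
    fix Y :: "'a opposite set" assume Y: "Y \<in> minimal_right_ideals"
    obtain J where "Y = to_opposite ` J" by (metis surj_image_to_opposite surjD)
    then show "Y \<in> ?B" using Y minimal_to_opposite_iff by blast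
  qed
qed (auto simp: minimal_to_opposite_iff)

lemma ideal_sum_to_opposite:
  assumes "\<F> \<subseteq> minimal_left_ideals"
  shows "ideal_sum ((`) to_opposite ` \<F>) = to_opposite ` ideal_sum \<F>"
  using assms
  by (intro ideal_sum_image left_ideal_add_closed)
    (auto simp: to_opposite_add to_opposite_zero minimal_left_ideals_def)

lemma right_order_to_opposite: "right_order (to_opposite ` J) = left_order J"
proof -
  let ?A = "{enat (card \<F>) | \<F>. finite \<F> \<and> \<F> \<subseteq> minimal_right_ideals \<and> to_opposite ` J = ideal_sum \<F>}"
  let ?B = "{enat (card \<F>) | \<F>. finite \<F> \<and> \<F> \<subseteq> minimal_left_ideals \<and> J = ideal_sum \<F>}"
  have inj: "inj_on ((`) to_opposite) \<F>" for \<F> :: "'a set set"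
    by (simp add: inj_on_def to_opposite_image_eq_iff)
  have "?A \<subseteq> ?B"
  proof
    fix n assume "n \<in> ?A"
    then obtain \<F> where F: "n = enat (card \<F>)" "finite \<F>" "\<F> \<subseteq> (`) to_opposite ` minimal_left_ideals"
        "to_opposite ` J = ideal_sum \<F>"
      unfolding minimal_right_ideals_opposite by blast
    obtain \<G> where G: "\<G> \<subseteq> minimal_left_ideals" "finite \<G>" "\<F> = (`) to_opposite ` \<G>"
      using finite_subset_image[OF F(2,3)] by blast
    have "J = ideal_sum \<G>"
      using F(4) unfolding G(3) ideal_sum_to_opposite[OF G(1)] to_opposite_image_eq_iff .
    then show "n \<in> ?B" using F(1) G card_image[OF inj, of \<G>] by auto
  qed
  moreover have "?B \<subseteq> ?A"
  proof
    fix n assume "n \<in> ?B"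
    then obtain \<F> where F: "n = enat (card \<F>)" "finite \<F>" "\<F> \<subseteq> minimal_left_ideals" "J = ideal_sum \<F>"
      by blast
    have "card ((`) to_opposite ` \<F>) = card \<F>" by (rule card_image[OF inj])
    then show "n \<in> ?A"
      using F ideal_sum_to_opposite[OF F(3)]
      by (intro CollectI exI[of _ "(`) to_opposite ` \<F>"]) (auto simp: minimal_to_opposite_iff)
  qed
  ultimately show ?thesis unfolding right_order_def left_order_def by simp
qed

lemma right_annihilator_to_opposite:
  "right_annihilator (to_opposite x) = to_opposite ` left_annihilator x"
proof
  show "right_annihilator (to_opposite x) \<subseteq> to_opposite ` left_annihilator x"
  proof
    fix a assume a: "a \<in> right_annihilator (to_opposite x)"
    obtain b where "a = to_opposite b" by (metis of_opposite_inverse)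
    then show "a \<in> to_opposite ` left_annihilator x"
      using a by (simp add: right_annihilator_def left_annihilator_def to_opposite_mult)
  qed
qed (auto simp: right_annihilator_def left_annihilator_def to_opposite_mult)

lemma range_to_opposite: "range ((*) (to_opposite y)) = to_opposite ` range (\<lambda>a. a * y)"
proof -
  have "range ((*) (to_opposite y)) = (*) (to_opposite y) ` range to_opposite"
    by (simp add: surj_to_opposite)
  then show ?thesis by (simp add: image_image to_opposite_mult)
qed

lemma left_annihilator_range_to_opposite:
  "to_opposite ` (left_annihilator x \<inter> range (\<lambda>a. a * x ^ m)) =
    right_annihilator (to_opposite x) \<inter> range ((*) (to_opposite x ^ m))"
  by (simp add: to_opposite_power range_to_opposite right_annihilator_to_opposite
      image_Int[OF inj_to_opposite])

lemma defect_eq_nullity_to_opposite: "defect x = nullity (to_opposite x)"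
  by (simp add: defect_def nullity_def right_annihilator_to_opposite right_order_to_opposite)

context semiprime_type
begin

lemma semiprime_type_opposite: "semiprime_type TYPE('a opposite)"
proof
  fix x :: "'a opposite" assume x: "x * r * x = 0" for r
  obtain y where y: "x = to_opposite y" by (metis of_opposite_inverse)
  have "y * r * y = 0" for r
    using x[of "to_opposite r"] by (simp add: y to_opposite_mult mult.assoc)
  then show "x = 0" using semiprime[of y] by (simp add: y)
qed

interpretation opp: semiprime_type "TYPE('a opposite)"
  by (rule semiprime_type_opposite)

text \<open>A minimal right ideal is \<open>f A\<close> with \<open>f\<close> idempotent, and
  \<open>A f\<close> is then a minimal left ideal. So \<open>f\<close> lands in the opposite socle,
  and \<open>f * r\<close> follows because that socle absorbs left factors.\<close>

lemma to_opposite_socle: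
  fixes t :: 'a
  assumes "t \<in> socle"
  shows "to_opposite t \<in> socle"
  using assms unfolding socle_def[where 'a = 'a]
proof (induction rule: ideal_sum_induct)
  case zero
  show ?case using opp.add_closed_socle by (simp add: to_opposite_zero add_closed_def)
next
  case (member S a)
  obtain f where f: "f * f = f" "S = range ((*) f)"
    using minimal_right_ideal_idempotent[OF member(1)] by metis
  have "to_opposite ` range (\<lambda>a. a * f) \<in> minimal_right_ideals"
    using minimal_left_ideal_idempotent[OF f(1)] member(1) by (simp add: f(2) minimal_to_opposite_iff)
  moreover have "to_opposite f \<in> to_opposite ` range (\<lambda>a. a * f)"
    using f(1) by (metis imageI rangeI)
  ultimately have fs: "to_opposite f \<in> socle"
    unfolding socle_def by (rule ideal_sum_member)
  obtain r where "a = f * r" using member(2) f(2) by blast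
  then have "to_opposite a = to_opposite r * to_opposite f" by (simp add: to_opposite_mult)
  then show ?case using fs opp.socle_mult_left by simp
next
  case (add a b)
  then show ?case using opp.add_closed_socle by (simp add: to_opposite_add[symmetric] add_closed_def)
qed

lemma left_annihilator_range_stabilizes:
  fixes x b :: 'a
  assumes "x ^ Suc k * b \<approx>\<^sub>s x ^ k"
  obtains M where "k \<le> M"
    "\<And>m. M \<le> m \<Longrightarrow> right_annihilator (to_opposite x) \<inter> range ((*) (to_opposite x ^ m)) =
      right_annihilator (to_opposite x) \<inter> range ((*) (to_opposite x ^ M))"
proof -
  have "to_opposite (x ^ Suc k * b - x ^ k) \<in> socle"
    using assms by (intro to_opposite_socle) (simp only: socle_cong_def)
  then have "to_opposite b * to_opposite x ^ Suc k \<approx>\<^sub>s to_opposite x ^ k"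
    by (simp only: socle_cong_def to_opposite_power to_opposite_mult to_opposite_diff)
  then show thesis using that by (rule opp.annihilator_range_stabilizes)
qed

end

section \<open>Perturbations in a Banach algebra\<close>

text \<open>The third conclusion is all the kernel argument sees of convergence: multiplication by
  \<open>p\<close> and \<open>a\<close> passes under the sum.\<close>

lemma neumann_series:
  fixes y :: "'a::complex_banach_algebra_1"
  assumes "norm y < 1"
  obtains v where "(1 - y) * v = 1" "v * (1 - y) = 1"
    "\<And>p a. (\<And>n. p * y ^ n * a = 0) \<Longrightarrow> p * v * a = 0"
proof -
  \<comment> \<open>Starting at exponent 1 is deliberate: \<open>norm 1\<close> may exceed 1, so the
    bound can fail for \<open>y ^ 0\<close>.\<close>
  have bound: "norm (y ^ Suc n) \<le> norm y ^ Suc n" for n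
  proof (induction n)
    case (Suc n)
    have "norm (y ^ Suc (Suc n)) \<le> norm y * norm (y ^ Suc n)"
      using norm_mult_ineq[of y "y ^ Suc n"] by simp
    also have "\<dots> \<le> norm y * norm y ^ Suc n" by (intro mult_left_mono Suc) simp
    finally show ?case by simp
  qed simp
  have "summable (\<lambda>n. norm y ^ Suc n)"
    using assms by (simp only: summable_Suc_iff) (simp add: summable_geometric)
  then have "summable (\<lambda>n. y ^ Suc n)"
    by (rule summable_comparison_test'[of _ 0]) (rule bound)
  then have sum: "summable (\<lambda>n. y ^ n)" by (simp only: summable_Suc_iff)
  define v where "v = (\<Sum>n. y ^ n)"
  have "(\<lambda>n. y ^ n) \<longlonglongrightarrow> 0" by (rule summable_LIMSEQ_zero[OF sum])
  then have tel: "(\<lambda>n. y ^ n - y ^ Suc n) sums 1"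
    using telescope_sums'[of "\<lambda>n. y ^ n" 0] by simp
  have "(1 - y) * v = (\<Sum>n. (1 - y) * y ^ n)"
    unfolding v_def by (rule suminf_mult[OF sum, symmetric])
  also have "\<dots> = 1" using sums_unique[OF tel] by (simp add: left_diff_distrib)
  finally have 1: "(1 - y) * v = 1" .
  have "v * (1 - y) = (\<Sum>n. y ^ n * (1 - y))"
    unfolding v_def by (rule suminf_mult2[OF sum])
  also have "\<dots> = 1"
    using sums_unique[OF tel] by (simp add: right_diff_distrib power_commutes)
  finally have 2: "v * (1 - y) = 1" .
  have "p * v * a = 0" if "\<And>n. p * y ^ n * a = 0" for p a
  proof -
    have "p * v = (\<Sum>n. p * y ^ n)"
      unfolding v_def by (rule suminf_mult[OF sum, symmetric])
    then have "p * v * a = (\<Sum>n. p * y ^ n * a)"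
      by (simp only: suminf_mult2[OF summable_mult[OF sum]])
    then show ?thesis using that by simp
  qed
  with 1 2 show thesis by (rule that)
qed

lemma scaleC_one_left: "(1::complex) *\<^sub>C a = (a::'a::complex_banach_algebra_1)"
  using scaleC_of_real[of 1 a] by simp

lemma scaleC_zero_right: "c *\<^sub>C 0 = (0::'a::complex_banach_algebra_1)"
  using mult_scaleC_left[of c "0::'a" 0] by (metis mult_scaleC_left mult_zero_right)

lemma scaleC_one_mult: "(c *\<^sub>C 1) * a = c *\<^sub>C (a::'a::complex_banach_algebra_1)"
  by (simp add: mult_scaleC_left)

lemma mult_scaleC_one: "a * (c *\<^sub>C 1) = c *\<^sub>C (a::'a::complex_banach_algebra_1)"
  by (simp add: mult_scaleC_right)

lemma power_scaleC: "(c *\<^sub>C a) ^ n = c ^ n *\<^sub>C (a::'a::complex_banach_algebra_1) ^ n"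
  by (induction n) (simp_all add: scaleC_one_left mult_scaleC_left mult_scaleC_right scaleC_scaleC mult.commute)

lemma neumann_series_scaleC:
  fixes s :: "'a::complex_banach_algebra_1"
  assumes "cmod \<mu> * norm s < 1"
  obtains v where "(1 - (\<mu> *\<^sub>C 1) * s) * v = 1" "v * (1 - (\<mu> *\<^sub>C 1) * s) = 1"
    "\<And>p a. (\<And>n. p * s ^ n * a = 0) \<Longrightarrow> p * v * a = 0"
proof -
  have "norm (\<mu> *\<^sub>C s) < 1" using assms by (simp add: norm_scaleC)
  then obtain v where v: "(1 - \<mu> *\<^sub>C s) * v = 1" "v * (1 - \<mu> *\<^sub>C s) = 1"
      "\<And>p a. (\<And>n. p * (\<mu> *\<^sub>C s) ^ n * a = 0) \<Longrightarrow> p * v * a = 0"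
    using neumann_series by blast
  have "p * v * a = 0" if "\<And>n. p * s ^ n * a = 0" for p a
    using that by (intro v(3))
      (simp add: power_scaleC mult_scaleC_left mult_scaleC_right scaleC_zero_right)
  with v(1,2) show thesis using that by (simp add: scaleC_one_mult)
qed

lemma nullity_perturbation:
  fixes x w :: "'a::complex_banach_algebra_1"
  assumes reg: "x ^ Suc M * w * x ^ Suc M = x ^ Suc M"
    and stab: "\<And>m. M \<le> m \<Longrightarrow>
      right_annihilator x \<inter> range ((*) (x ^ m)) = right_annihilator x \<inter> range ((*) (x ^ M))"
    and \<mu>: "\<mu> \<noteq> 0" "cmod \<mu> * norm (x ^ M * w) < 1"
  shows "nullity (x - \<mu> *\<^sub>C 1) = right_order (right_annihilator x \<inter> range ((*) (x ^ M)))"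
proof -
  obtain v where v: "(1 - (\<mu> *\<^sub>C 1) * (x ^ M * w)) * v = 1" "v * (1 - (\<mu> *\<^sub>C 1) * (x ^ M * w)) = 1"
      "\<And>p a. (\<And>n. p * (x ^ M * w) ^ n * a = 0) \<Longrightarrow> p * v * a = 0"
    using neumann_series_scaleC[OF \<mu>(2)] by blast
  have "right_annihilator (x - \<mu> *\<^sub>C 1) = (*) v ` (right_annihilator x \<inter> range ((*) (x ^ M)))"
  proof (rule right_annihilator_perturbation[OF reg stab _ _ v(3) v(2) v(1)])
    show "\<mu> *\<^sub>C 1 * a = a * \<mu> *\<^sub>C 1" for a :: 'a
      by (simp add: scaleC_one_mult mult_scaleC_one)
    show "\<mu> *\<^sub>C 1 * inverse \<mu> *\<^sub>C 1 = (1::'a)"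
      using \<mu>(1) by (simp add: scaleC_one_mult scaleC_scaleC scaleC_one_left)
  qed
  then show ?thesis
    unfolding nullity_def using right_order_image_left_invertible[OF v(1)] by simp
qed

text \<open>The Neumann series is summed in the normed algebra for \<open>w * x ^ M\<close>, and
  only its value is transported to the opposite ring.\<close>

lemma defect_perturbation:
  fixes x w :: "'a::complex_banach_algebra_1"
  assumes reg: "x ^ Suc M * w * x ^ Suc M = x ^ Suc M"
    and stab: "\<And>m. M \<le> m \<Longrightarrow>
      right_annihilator (to_opposite x) \<inter> range ((*) (to_opposite x ^ m)) =
      right_annihilator (to_opposite x) \<inter> range ((*) (to_opposite x ^ M))"
    and \<mu>: "\<mu> \<noteq> 0" "cmod \<mu> * norm (w * x ^ M) < 1"
  shows "defect (x - \<mu> *\<^sub>C 1) = left_order (left_annihilator x \<inter> range (\<lambda>a. a * x ^ M))"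
proof -
  let ?z = "to_opposite (\<mu> *\<^sub>C 1 :: 'a)"
  let ?s = "to_opposite x ^ M * to_opposite w"
  have s: "?s = to_opposite (w * x ^ M)" by (simp add: to_opposite_power to_opposite_mult)
  obtain v where v: "(1 - (\<mu> *\<^sub>C 1) * (w * x ^ M)) * v = 1" "v * (1 - (\<mu> *\<^sub>C 1) * (w * x ^ M)) = 1"
      "\<And>p a. (\<And>n. p * (w * x ^ M) ^ n * a = 0) \<Longrightarrow> p * v * a = 0"
    using neumann_series_scaleC[OF \<mu>(2)] by blast
  have u: "1 - ?z * ?s = to_opposite (1 - (\<mu> *\<^sub>C 1) * (w * x ^ M))"
    unfolding s to_opposite_mult to_opposite_one[symmetric] to_opposite_diff
    by (simp add: scaleC_one_mult mult_scaleC_one)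
  have inv: "to_opposite v * (1 - ?z * ?s) = 1" "(1 - ?z * ?s) * to_opposite v = 1"
    unfolding u to_opposite_mult v(1,2) by (rule to_opposite_one)+
  have "right_annihilator (to_opposite x - ?z) =
      (*) (to_opposite v) ` (right_annihilator (to_opposite x) \<inter> range ((*) (to_opposite x ^ M)))"
  proof (rule right_annihilator_perturbation[OF _ stab _ _ _ inv])
    show "to_opposite x ^ Suc M * to_opposite w * to_opposite x ^ Suc M = to_opposite x ^ Suc M"
      using reg by (simp only: to_opposite_power to_opposite_mult mult.assoc)
    show "?z * a = a * ?z" for a
    proof -
      obtain a' where "a = to_opposite a'" by (metis of_opposite_inverse)
      then show ?thesis by (simp add: to_opposite_mult scaleC_one_mult mult_scaleC_one)
    qed
    show "?z * to_opposite (inverse \<mu> *\<^sub>C 1) = 1"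
      using \<mu>(1) unfolding to_opposite_mult to_opposite_one[symmetric]
      by (simp add: scaleC_one_mult scaleC_scaleC scaleC_one_left)
    \<comment> \<open>Products reverse, so \<open>p\<close> and \<open>a\<close> exchange their
      sides; the two-sided form of the limit property is made for this.\<close>
    fix p a :: "'a opposite" assume 0: "p * ?s ^ n * a = 0" for n
    obtain p' a' where pa: "p = to_opposite p'" "a = to_opposite a'"
      by (metis of_opposite_inverse)
    have "a' * (w * x ^ M) ^ n * p' = 0" for n
      using 0[of n] unfolding s pa by (simp add: to_opposite_power to_opposite_mult mult.assoc)
    then have "a' * v * p' = 0" by (rule v(3))
    then show "p * to_opposite v * a = 0"
      unfolding pa by (simp add: to_opposite_mult mult.assoc)
  qed
  then have "right_order (right_annihilator (to_opposite x - ?z)) =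
      right_order (right_annihilator (to_opposite x) \<inter> range ((*) (to_opposite x ^ M)))"
    using right_order_image_left_invertible[OF inv(2)] by simp
  then show ?thesis
    by (simp add: defect_eq_nullity_to_opposite nullity_def to_opposite_diff
        left_annihilator_range_to_opposite[symmetric] right_order_to_opposite)
qed

text \<open>Where \<open>x ^ k\<close> vanishes modulo the socle, the cofactor \<open>g\<close>
  inverts \<open>x - z\<close> up to the factor \<open>- (z ^ k)\<close>.\<close>

lemma power_diff_factor:
  fixes x z :: "'a::ring_1"
  assumes "x * z = z * x"
  obtains g where "(x - z) * g = x ^ k - z ^ k" "g * (x - z) = x ^ k - z ^ k"
proof -
  have comm: "x * z ^ k = z ^ k * x" for k
    by (induction k) (simp_all add: assms mult.assoc, metis assms mult.assoc)
  have "\<exists>g. (x - z) * g = x ^ k - z ^ k \<and> g * (x - z) = x ^ k - z ^ k"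
  proof (induction k)
    case 0
    show ?case by (rule exI[of _ 0]) simp
  next
    case (Suc k)
    then obtain g where g: "(x - z) * g = x ^ k - z ^ k" "g * (x - z) = x ^ k - z ^ k" by blast
    have "(x - z) * (g * x + z ^ k) = (x ^ k - z ^ k) * x + (x - z) * z ^ k"
      by (simp only: distrib_left mult.assoc[symmetric] g)
    also have "\<dots> = x ^ Suc k - z ^ Suc k"
      using comm[of k] by (simp add: algebra_simps power_commutes)
    finally have 1: "(x - z) * (g * x + z ^ k) = x ^ Suc k - z ^ Suc k" .
    have "x * (x - z) = (x - z) * x" using assms by (simp add: algebra_simps)
    then have "(g * x + z ^ k) * (x - z) = (x ^ k - z ^ k) * x + z ^ k * (x - z)"
      by (metis distrib_right mult.assoc g(2))
    also have "\<dots> = x ^ Suc k - z ^ Suc k"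
      by (simp add: algebra_simps power_commutes)
    finally show ?case using 1 by blast
  qed
  then show thesis using that by blast
qed

text \<open>With \<open>p = x b\<close> the image of \<open>x - z\<close> splits into \<open>(1 - z b) x p\<close>, inverted by \<open>b (1 - z b)\<^sup>-\<^sup>1\<close>, and
  the nilpotent part \<open>x (1 - p)\<close> minus a nonzero scalar.\<close>

lemma (in semiprime_type) fredholm_perturbation:
  fixes x b z z' v :: 'a
  assumes comm: "x * b \<approx>\<^sub>s b * x" and bxb: "b * x * b \<approx>\<^sub>s b"
    and left: "b * x ^ Suc k \<approx>\<^sub>s x ^ k" and right: "x ^ Suc k * b \<approx>\<^sub>s x ^ k"
    and central: "\<And>a. z * a = a * z" and z: "z * z' = 1"
    and v: "v * (1 - z * b) = 1" "(1 - z * b) * v = 1"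
  shows "fredholm (x - z)"
proof -
  obtain g where g: "(x - z) * g = x ^ k - z ^ k" "g * (x - z) = x ^ k - z ^ k"
    using power_diff_factor[of x z] central by metis
  have z': "z' * z = 1" using central[of z'] z by simp
  have zk: "z' ^ k * z ^ k = 1" "z ^ k * z' ^ k = 1"
    using left_right_inverse_power[OF z'] left_right_inverse_power[OF z] by blast+
  have zk_central: "z ^ k * a = a * z ^ k" for a
    by (induction k) (simp_all add: mult.assoc, metis central mult.assoc)
  \<comment> \<open>\<open>x * b * b\<close> is congruent to \<open>b * x * b\<close> and so to
    \<open>b\<close>; hence \<open>b * v\<close> inverts \<open>x - z\<close> on the part cut out by
    \<open>x * b\<close>.\<close>
  have "x * b * (1 - z * b) \<approx>\<^sub>s (x - z) * b"
  proof -
    have "x * b * (1 - z * b) = x * b - z * ((x * b) * b)"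
      using central by (simp add: right_diff_distrib) (metis mult.assoc)
    also have "\<dots> \<approx>\<^sub>s x * b - z * (b * x * b)"
      by (intro socle_cong_diff socle_cong_mult_left socle_cong_mult_right comm socle_cong_refl)
    also have "\<dots> \<approx>\<^sub>s x * b - z * b"
      by (intro socle_cong_diff socle_cong_mult_left bxb socle_cong_refl)
    finally show ?thesis by (simp add: left_diff_distrib)
  qed
  then have "x * b * (1 - z * b) * v \<approx>\<^sub>s (x - z) * b * v" by (rule socle_cong_mult_right)
  then have r1: "(x - z) * (b * v) \<approx>\<^sub>s x * b"
    using v(2) by (simp add: mult.assoc socle_cong_sym)
  \<comment> \<open>On the complement \<open>1 - x * b\<close> the power \<open>x ^ k\<close> dies
    modulo the socle, leaving the invertible \<open>- (z ^ k)\<close>. Subtracting this part from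
    the first one makes the right-hand sides add up to 1.\<close>
  have "(x - z) * (g * (1 - x * b)) = (x ^ k - z ^ k) * (1 - x * b)"
    by (simp only: mult.assoc[symmetric] g)
  also have "\<dots> = (x ^ k - x ^ Suc k * b) - z ^ k * (1 - x * b)"
    by (simp add: left_diff_distrib right_diff_distrib power_Suc2 mult.assoc del: power_Suc)
  also have "\<dots> \<approx>\<^sub>s (x ^ k - x ^ k) - z ^ k * (1 - x * b)"
    by (intro socle_cong_diff right socle_cong_refl)
  finally have "(x - z) * (g * (1 - x * b)) * z' ^ k \<approx>\<^sub>s (x ^ k - x ^ k - z ^ k * (1 - x * b)) * z' ^ k"
    by (rule socle_cong_mult_right)
  also have "(x ^ k - x ^ k - z ^ k * (1 - x * b)) * z' ^ k = - ((1 - x * b) * (z ^ k * z' ^ k))"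
    by (simp add: zk_central mult.assoc)
  finally have r2: "(x - z) * (g * (1 - x * b) * z' ^ k) \<approx>\<^sub>s - (1 - x * b)"
    by (simp add: zk(2) mult.assoc)
  have "(x - z) * (b * v) - (x - z) * (g * (1 - x * b) * z' ^ k) \<approx>\<^sub>s x * b - - (1 - x * b)"
    by (rule socle_cong_diff[OF r1 r2])
  then have right_inv: "(x - z) * (b * v - g * (1 - x * b) * z' ^ k) \<approx>\<^sub>s 1"
    by (simp only: right_diff_distrib[of "x - z"]) simp
  \<comment> \<open>Mirror image: the left inverse is built around \<open>b * x\<close>, which
    agrees with \<open>x * b\<close> only modulo the socle.\<close>
  have "(1 - z * b) * (b * x) \<approx>\<^sub>s b * (x - z)"
  proof -
    have "(1 - z * b) * (b * x) = b * x - z * (b * (b * x))"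
      by (simp add: left_diff_distrib mult.assoc)
    also have "\<dots> \<approx>\<^sub>s b * x - z * (b * (x * b))"
      by (intro socle_cong_diff socle_cong_mult_left socle_cong_sym[OF comm] socle_cong_refl)
    also have "b * x - z * (b * (x * b)) = b * x - z * (b * x * b)" by (simp add: mult.assoc)
    also have "\<dots> \<approx>\<^sub>s b * x - z * b"
      by (intro socle_cong_diff socle_cong_mult_left bxb socle_cong_refl)
    finally show ?thesis using central[of b] by (simp add: right_diff_distrib)
  qed
  then have "v * ((1 - z * b) * (b * x)) \<approx>\<^sub>s v * (b * (x - z))" by (rule socle_cong_mult_left)
  then have l1: "(v * b) * (x - z) \<approx>\<^sub>s b * x"
    using v(1) by (simp add: mult.assoc[symmetric] socle_cong_sym)
  have "((1 - b * x) * g) * (x - z) = (1 - b * x) * (x ^ k - z ^ k)"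
    by (simp only: mult.assoc g)
  also have "\<dots> = (x ^ k - b * x ^ Suc k) - z ^ k * (1 - b * x)"
    by (simp add: zk_central algebra_simps mult.assoc)
  also have "\<dots> \<approx>\<^sub>s (x ^ k - x ^ k) - z ^ k * (1 - b * x)"
    by (intro socle_cong_diff left socle_cong_refl)
  finally have "z' ^ k * (((1 - b * x) * g) * (x - z)) \<approx>\<^sub>s z' ^ k * (x ^ k - x ^ k - z ^ k * (1 - b * x))"
    by (rule socle_cong_mult_left)
  also have "z' ^ k * (x ^ k - x ^ k - z ^ k * (1 - b * x)) = - ((z' ^ k * z ^ k) * (1 - b * x))"
    by (simp add: mult.assoc)
  finally have l2: "(z' ^ k * ((1 - b * x) * g)) * (x - z) \<approx>\<^sub>s - (1 - b * x)"
    by (simp add: zk(1) mult.assoc)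
  have "(v * b) * (x - z) - (z' ^ k * ((1 - b * x) * g)) * (x - z) \<approx>\<^sub>s b * x - - (1 - b * x)"
    by (rule socle_cong_diff[OF l1 l2])
  then have "(v * b - z' ^ k * ((1 - b * x) * g)) * (x - z) \<approx>\<^sub>s 1"
    by (simp only: left_diff_distrib[of _ _ "x - z"]) simp
  with right_inv show ?thesis by (rule fredholmI)
qed

theorem theorem2p7:
  fixes x :: "'a::complex_banach_algebra_1"
  assumes "semiprime_ring (ring_of_type_algebra :: 'a ring)"
    and "(socle :: 'a set) \<noteq> {0}"
    and "b_fredholm x"
  shows "\<exists>\<epsilon>>0. \<exists>M::nat. \<forall>m\<ge>M. \<forall>\<mu>::complex. 0 < cmod \<mu> \<and> cmod \<mu> < \<epsilon> \<longrightarrow>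
    fredholm (x - \<mu> *\<^sub>C 1) \<and>
    (nullity (x - \<mu> *\<^sub>C 1) = right_order (right_annihilator x \<inter> range (\<lambda>a. x ^ m * a)) \<and>
     right_order (right_annihilator x \<inter> range (\<lambda>a. x ^ m * a)) \<le> nullity x) \<and>
    (defect (x - \<mu> *\<^sub>C 1) = left_order (left_annihilator x \<inter> range (\<lambda>a. a * x ^ m)) \<and>
     left_order (left_annihilator x \<inter> range (\<lambda>a. a * x ^ m)) \<le> defect x)"
proof -
  interpret semiprime_type "TYPE('a)"
    using assms(1) by (rule semiprime_ring_imp_semiprime_type)
  interpret opp: semiprime_type "TYPE('a opposite)"
    by (rule semiprime_type_opposite)
  obtain b k where b: "x * b \<approx>\<^sub>s b * x" "b * x * b \<approx>\<^sub>s b" "x ^ k * b * x \<approx>\<^sub>s x ^ k"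
    using b_fredholmE[OF assms(3)] .
  \<comment> \<open>Commuting turns the Drazin relation into its two one-sided forms:
    \<open>left\<close> controls right annihilators, \<open>right\<close> controls left
    ones.\<close>
  have "b * x ^ Suc k = (b * x ^ k) * x" by (simp only: power_Suc2 mult.assoc)
  also have "\<dots> \<approx>\<^sub>s (x ^ k * b) * x"
    by (rule socle_cong_mult_right[OF socle_cong_sym[OF socle_cong_power_commute[OF b(1)]]])
  also note b(3)
  finally have left: "b * x ^ Suc k \<approx>\<^sub>s x ^ k" .
  have "x ^ Suc k * b = x ^ k * (x * b)" by (simp only: power_Suc2 mult.assoc)
  also have "\<dots> \<approx>\<^sub>s x ^ k * (b * x)" by (rule socle_cong_mult_left[OF b(1)])
  also have "x ^ k * (b * x) = x ^ k * b * x" by (simp only: mult.assoc)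
  also note b(3)
  finally have right: "x ^ Suc k * b \<approx>\<^sub>s x ^ k" .

  define K where "K = (\<lambda>m. right_annihilator x \<inter> range ((*) (x ^ m)))"
  define L where "L = (\<lambda>m. right_annihilator (to_opposite x) \<inter> range ((*) (to_opposite x ^ m)))"
  obtain M\<^sub>1 where M1: "k \<le> M\<^sub>1" "\<And>m. M\<^sub>1 \<le> m \<Longrightarrow> K m = K M\<^sub>1"
    using annihilator_range_stabilizes[OF left] unfolding K_def by blast
  obtain M\<^sub>2 where M2: "k \<le> M\<^sub>2" "\<And>m. M\<^sub>2 \<le> m \<Longrightarrow> L m = L M\<^sub>2"
    using left_annihilator_range_stabilizes[OF right] unfolding L_def by blast
  \<comment> \<open>A common exponent, so that one \<open>w\<close> serves both the nullity and the
    defect.\<close>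
  define M where "M = max M\<^sub>1 M\<^sub>2"
  have K: "K m = K M" if "M \<le> m" for m
    using M1(2)[of m] M1(2)[of M] that by (simp add: M_def)
  have L: "L m = L M" if "M \<le> m" for m
    using M2(2)[of m] M2(2)[of M] that by (simp add: M_def)
  have "k \<le> Suc M" using M1(1) by (simp add: M_def)
  then obtain w where w: "x ^ Suc M * w * x ^ Suc M = x ^ Suc M"
    by (rule power_regular[OF b(1) left])

  \<comment> \<open>Three Neumann series must converge at once: for the nullity, the defect and the
    Fredholm property. The summand 1 keeps \<open>C\<close> positive.\<close>
  define C where "C = 1 + norm (x ^ M * w) + norm (w * x ^ M) + norm b"
  have C: "C > 0" "norm (x ^ M * w) \<le> C" "norm (w * x ^ M) \<le> C" "norm b \<le> C"
    using norm_ge_zero[of "x ^ M * w"] norm_ge_zero[of "w * x ^ M"] norm_ge_zero[of b]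
    unfolding C_def by linarith+

  show ?thesis
  proof (intro exI[of _ "1 / C"] exI[of _ M] conjI allI impI)
    show "0 < 1 / C" using C(1) by simp
    fix m \<mu> assume m: "M \<le> m" and "0 < cmod \<mu> \<and> cmod \<mu> < 1 / C"
    then have \<mu>: "\<mu> \<noteq> 0" "cmod \<mu> * C < 1" using C(1) by (auto simp: field_simps)
    have small: "cmod \<mu> * norm a < 1" if "norm a \<le> C" for a :: 'a
      using mult_left_mono[OF that, of "cmod \<mu>"] \<mu>(2) by simp
    obtain v where v: "(1 - (\<mu> *\<^sub>C 1) * b) * v = 1" "v * (1 - (\<mu> *\<^sub>C 1) * b) = 1"
      using neumann_series_scaleC[OF small[OF C(4)]] by metis
    have "\<mu> *\<^sub>C 1 * a = a * \<mu> *\<^sub>C 1" for a :: 'a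
      by (simp add: scaleC_one_mult mult_scaleC_one)
    moreover have "\<mu> *\<^sub>C 1 * inverse \<mu> *\<^sub>C 1 = (1::'a)"
      using \<mu>(1) by (simp add: scaleC_one_mult scaleC_scaleC scaleC_one_left)
    ultimately show "fredholm (x - \<mu> *\<^sub>C 1)"
      using v by (intro fredholm_perturbation[OF b(1,2) left right])
    have "nullity (x - \<mu> *\<^sub>C 1) = right_order (K M)"
      unfolding K_def using K[unfolded K_def] \<mu>(1) small[OF C(2)]
      by (rule nullity_perturbation[OF w])
    then show "nullity (x - \<mu> *\<^sub>C 1) = right_order (right_annihilator x \<inter> range ((*) (x ^ m)))"
      using K[OF m] by (simp add: K_def)
    \<comment> \<open>Monotonicity of the order also covers infinite nullity.\<close>
    show "right_order (right_annihilator x \<inter> range ((*) (x ^ m))) \<le> nullity x"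
      unfolding nullity_def
      by (intro right_order_mono right_ideal_Int right_ideal_annihilator right_ideal_range) simp
    have L_opp: "L j = to_opposite ` (left_annihilator x \<inter> range (\<lambda>a. a * x ^ j))" for j
      by (simp only: L_def left_annihilator_range_to_opposite)
    have "defect (x - \<mu> *\<^sub>C 1) = left_order (left_annihilator x \<inter> range (\<lambda>a. a * x ^ M))"
      using L[unfolded L_def] \<mu>(1) small[OF C(3)] by (rule defect_perturbation[OF w])
    then show "defect (x - \<mu> *\<^sub>C 1) = left_order (left_annihilator x \<inter> range (\<lambda>a. a * x ^ m))"
      using L[OF m] by (simp add: L_opp to_opposite_image_eq_iff)
    have "right_order (L m) \<le> nullity (to_opposite x)"
      unfolding nullity_def L_def
      by (intro opp.right_order_mono right_ideal_Int right_ideal_annihilator right_ideal_range) simp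
    then show "left_order (left_annihilator x \<inter> range (\<lambda>a. a * x ^ m)) \<le> defect x"
      by (simp add: L_opp right_order_to_opposite defect_eq_nullity_to_opposite)
  qed
qed

end
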